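(* Let $i,j$ be real numbers with $0<j\le i<1$ and $i+j=1$. Let $I\subset\mathbb{R}$ be a compact interval and let $f\in C^{(2)}(I)$ satisfy $f''(x)\neq 0$ for all $x\in I$. Then for every $\boldsymbol\theta=(\gamma,\delta)\in\mathbb{R}^2$, the set $\mathrm{Bad}^f_{\boldsymbol\theta}(i,j):=\{x\in I:(x,f(x))\in\mathrm{Bad}_{\boldsymbol\theta}(i,j)\}$ is a $1/2$-winning subset of $I$.
   Context: For $t\in\mathbb{R}$, $\|t\|$ denotes the distance from $t$ to the nearest integer. For $\boldsymbol\theta=(\gamma,\delta)\in\mathbb{R}^2$, $\mathrm{Bad}_{\boldsymbol\theta}(i,j)$ is the set of $(x,y)\in\mathbb{R}^2$ for which there is $c(x,y)>0$ with $\max\{\|qx-\gamma\|^{1/i},\|qy-\delta\|^{1/j}\}>c(x,y)\,q^{-1}$ for all $q\in\mathbb{N}$. Schmidt's $(\alpha,\beta)$-game on $I$: for $0<\alpha,\beta<1$, player B chooses a closed interval $B_0\subset I$; then A chooses a closed interval $A_0\subset B_0$ of length $\alpha|B_0|$; then B chooses a closed interval $B_1\subset A_0$ of length $\beta|A_0|$, and so on alternately, giving nested intervals $B_0\supset A_0\supset B_1\supset\cdots$. A set $X\subset I$ is $(\alpha,\beta)$-winning if A can play so that the unique point of $\bigcap_n B_n$ lies in $X$ regardless of how B plays; it is $\alpha$-winning if it is $(\alpha,\beta)$-winning for every $\beta\in(0,1)$. *)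

theory Defs
  imports "HOL-Analysis.Analysis"
begin

definition dist_int :: "real \<Rightarrow> real" where
  "dist_int t = \<bar>t - of_int (round t)\<bar>"

text \<open>Here the denominators \<open>q\<close> range over the positive integers.\<close>

definition Bad :: "real \<times> real \<Rightarrow> real \<Rightarrow> real \<Rightarrow> (real \<times> real) set" where
  "Bad \<theta> i j =
    {(x, y). \<exists>c>0. \<forall>q::nat. q \<ge> 1 \<longrightarrow>
       max (dist_int (real q * x - fst \<theta>) powr (1 / i))
           (dist_int (real q * y - snd \<theta>) powr (1 / j)) > c / real q}"

definition Bad_curve :: "real set \<Rightarrow> (real \<Rightarrow> real) \<Rightarrow> real \<times> real \<Rightarrow> real \<Rightarrow> real \<Rightarrow> real set" where
  "Bad_curve I f \<theta> i j = {x \<in> I. (x, f x) \<in> Bad \<theta> i j}"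

text \<open>Intervals in the game are nondegenerate; otherwise B could choose a single point and win
  against any proper subset.\<close>

definition closed_interval :: "real set \<Rightarrow> bool" where
  "closed_interval J \<longleftrightarrow> (\<exists>l u. l < u \<and> J = {l..u})"

text \<open>\<open>subinterval_ratio r J K\<close>: \<open>K\<close> is a legal choice inside \<open>J\<close> for a player whose parameter
  is \<open>r\<close>.\<close>

definition subinterval_ratio :: "real \<Rightarrow> real set \<Rightarrow> real set \<Rightarrow> bool" where
  "subinterval_ratio r J K \<longleftrightarrow>
     closed_interval K \<and> K \<subseteq> J \<and> measure lborel K = r * measure lborel J"

text \<open>A strategy for A maps the history \<open>[B\<^sub>0, \<dots>, B\<^sub>n]\<close> of the moves of B to the move \<open>A\<^sub>n\<close>.
  It has to answer every history legally, so that A cannot win by making an illegal move that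
  leaves B without a continuation.\<close>

definition strategy_A :: "real \<Rightarrow> (real set list \<Rightarrow> real set) \<Rightarrow> bool" where
  "strategy_A \<alpha> \<sigma> \<longleftrightarrow>
     (\<forall>Bs. Bs \<noteq> [] \<and> closed_interval (last Bs) \<longrightarrow> subinterval_ratio \<alpha> (last Bs) (\<sigma> Bs))"

definition legal_B ::
    "real set \<Rightarrow> real \<Rightarrow> (real set list \<Rightarrow> real set) \<Rightarrow> (nat \<Rightarrow> real set) \<Rightarrow> bool" where
  "legal_B I \<beta> \<sigma> B \<longleftrightarrow>
     closed_interval (B 0) \<and> B 0 \<subseteq> I \<and>
     (\<forall>n. subinterval_ratio \<beta> (\<sigma> (map B [0..<Suc n])) (B (Suc n)))"

definition game_winning :: "real set \<Rightarrow> real \<Rightarrow> real \<Rightarrow> real set \<Rightarrow> bool" where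
  "game_winning I \<alpha> \<beta> X \<longleftrightarrow> X \<subseteq> I \<and>
     (\<exists>\<sigma>. strategy_A \<alpha> \<sigma> \<and> (\<forall>B. legal_B I \<beta> \<sigma> B \<longrightarrow> (\<exists>x\<in>X. (\<Inter>n. B n) = {x})))"

definition alpha_winning :: "real set \<Rightarrow> real \<Rightarrow> real set \<Rightarrow> bool" where
  "alpha_winning I \<alpha> X \<longleftrightarrow> (\<forall>\<beta>. 0 < \<beta> \<and> \<beta> < 1 \<longrightarrow> game_winning I \<alpha> \<beta> X)"

end

(*
  A point x outside the set has a rational point P = (p/q, r/q) too close to (x, f x); take q minimal.
  By pigeonhole P lies on a line A X + B Y + C = 0 with |A| <= q^i and |B| <= q^j, so
  F(x) = A x + B f(x) + C is O(c/q) at x. Sort the pairs (x, P) dyadically by q, by the slope F'(x) and by B.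
  Two pairs of one class whose x are within a certain distance l give proportional lines: otherwise the
  lines meet in a rational point that is again close to (x, f x), and either its denominator is smaller than q
  (excluded by minimality) or it equals both given points. As f'' does not vanish, the set where |F| is small
  then has, inside an interval of length l, much smaller diameter h than l. So each class is a "clumped" set. Once homogeneous
  solutions are excluded, the inhomogeneous ones with q of a given dyadic size are clumped as well, since the
  difference of two of them is a homogeneous solution.

  In the game A answers each clump from the moment the current interval is shorter than l, by marking the two
  ends of the clump. Choosing the better half halves the weighted number of marked points in the interval,
  with weights that grow by a factor 3/2 per round; this beats the newly marked points because h/l is small and
  decays geometrically over the classes that are marked at the same time.
*)


theory Submission imports Defs begin

text \<open>The length l and the diameter h pull against each other. Classes with many different
  slope and coefficient indices k, v can fall due in one round, so h/l must decay in both, and l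
  must be enlarged by a factor X growing with k + v. But over a larger l two lines of one class are
  only known to be O(X c/q) at each other's points, which endangers parallelism. What pays for this
  is i + j = 1: the slope and coefficient bounds together lower the determinant of two lines by
  2^(k+v). The test for a smaller homogeneous solution thereby gains at least 2^((k+v)j), so X can
  be X0 times 2^((k+v)j/2), with half of the saving left over. For bounded k + v the saving is too
  small; there c is so small that both given points lie on both lines. Such an order exists because
  the weight of the clumps is bounded uniformly in their scales. Player A chooses the clumps only
  after seeing B's first interval, so that none is due at the start.\<close>

subsection \<open>Avoiding clumps in the game\<close>

text \<open>Interior points count twice, so that the two halves of an interval together count a point no more
  often than the interval does, even when the point is the midpoint.\<close>

definition endpoint_count :: "real \<Rightarrow> real set \<Rightarrow> ennreal" where
  "endpoint_count p J = (if p \<in> interior J then 2 else if p \<in> J then 1 else 0)"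

lemma endpoint_count_mono: "K \<subseteq> J \<Longrightarrow> endpoint_count p K \<le> endpoint_count p J"
  using interior_mono[of K J] interior_subset[of J]
  by (auto simp: endpoint_count_def)

lemma endpoint_count_le: "endpoint_count p J \<le> 2"
  by (auto simp: endpoint_count_def)

lemma endpoint_count_ge: "p \<in> J \<Longrightarrow> 1 \<le> endpoint_count p J"
  by (auto simp: endpoint_count_def)

lemma endpoint_count_halves:
  assumes "l < m" "m < r"
  shows "endpoint_count p {l..m} + endpoint_count p {m..r} \<le> endpoint_count p {l..r}"
  using assms by (auto simp: endpoint_count_def)

section \<open>The potential of the marked points and the halving strategy\<close>

definition potential ::
  "('k \<Rightarrow> real set) \<Rightarrow> ('k \<Rightarrow> real) \<Rightarrow> ('k \<Rightarrow> nat) \<Rightarrow> real \<Rightarrow> real set list \<Rightarrow> real set \<Rightarrow> ennreal" where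
  "potential Z h lev s Bs J =
    (\<integral>\<^sup>+\<kappa>. (if lev \<kappa> < length Bs \<and> Z \<kappa> \<inter> Bs ! lev \<kappa> \<noteq> {}
      then ennreal (h \<kappa> powr s) *
        (endpoint_count (Inf (Z \<kappa> \<inter> Bs ! lev \<kappa>)) J + endpoint_count (Sup (Z \<kappa> \<inter> Bs ! lev \<kappa>)) J)
      else 0) \<partial>count_space UNIV)"

lemma potential_mono: "K \<subseteq> J \<Longrightarrow> potential Z h lev s Bs K \<le> potential Z h lev s Bs J"
  unfolding potential_def
  by (intro nn_integral_mono) (auto intro!: mult_left_mono add_mono endpoint_count_mono)

lemma potential_halves:
  assumes "l < m" "m < r"
  shows "potential Z h lev s Bs {l..m} + potential Z h lev s Bs {m..r} \<le> potential Z h lev s Bs {l..r}"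
proof -
  have four: "x + y + (z + w) \<le> u + v" if "x + z \<le> u" "y + w \<le> v" for x y z w u v :: ennreal
    using add_mono[OF that] by (simp add: ac_simps)
  have *: "(if P then c * (x + y) else 0) + (if P then c * (z + w) else 0) \<le> (if P then c * (u + v) else 0)"
    if "x + z \<le> u" "y + w \<le> v" for x y z w u v c :: ennreal and P
    using mult_left_mono[OF four[OF that], of c] by (simp add: distrib_left)
  show ?thesis
    unfolding potential_def
    by (subst nn_integral_add[symmetric]; (intro nn_integral_mono *)?)
       (use endpoint_count_halves[OF assms] in auto)
qed

lemma potential_ge_term:
  assumes "lev \<kappa> < length Bs" "Z \<kappa> \<inter> Bs ! lev \<kappa> \<noteq> {}"
  shows "ennreal (h \<kappa> powr s) *
    (endpoint_count (Inf (Z \<kappa> \<inter> Bs ! lev \<kappa>)) J + endpoint_count (Sup (Z \<kappa> \<inter> Bs ! lev \<kappa>)) J)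
    \<le> potential Z h lev s Bs J"
  unfolding potential_def
  by (rule order_trans[OF _ nn_integral_ge_point[of \<kappa>]]) (use assms in auto)

text \<open>A newly marked clump has two ends, each counted at most twice: hence the factor
  4.\<close>

lemma potential_extend:
  "potential Z h lev s (Bs @ [B]) J \<le> potential Z h lev s Bs J +
    4 * (\<integral>\<^sup>+\<kappa>. (if lev \<kappa> = length Bs then ennreal (h \<kappa> powr s) else 0) \<partial>count_space UNIV)"
proof -
  have four: "endpoint_count p J + endpoint_count q J \<le> 4" for p q
    using add_mono[OF endpoint_count_le[of p J] endpoint_count_le[of q J]] by simp
  have "potential Z h lev s (Bs @ [B]) J \<le> 
     (\<integral>\<^sup>+\<kappa>. ((if lev \<kappa> < length Bs \<and> Z \<kappa> \<inter> Bs ! lev \<kappa> \<noteq> {}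
      then ennreal (h \<kappa> powr s) *
        (endpoint_count (Inf (Z \<kappa> \<inter> Bs ! lev \<kappa>)) J + endpoint_count (Sup (Z \<kappa> \<inter> Bs ! lev \<kappa>)) J)
      else 0) + 4 * (if lev \<kappa> = length Bs then ennreal (h \<kappa> powr s) else 0)) \<partial>count_space UNIV)"
    unfolding potential_def
    apply (intro nn_integral_mono)
    subgoal for \<kappa>
      using mult_left_mono[OF four, of "ennreal (h \<kappa> powr s)"]
      by (auto simp: nth_append less_Suc_eq mult.commute)
    done
  also have "\<dots> = potential Z h lev s Bs J +
    4 * (\<integral>\<^sup>+\<kappa>. (if lev \<kappa> = length Bs then ennreal (h \<kappa> powr s) else 0) \<partial>count_space UNIV)"
    unfolding potential_def
    by (subst nn_integral_add) (auto simp: nn_integral_cmult)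
  finally show ?thesis .
qed

definition halving_strategy :: "(real set list \<Rightarrow> real set \<Rightarrow> ennreal) \<Rightarrow> real set list \<Rightarrow> real set" where
  "halving_strategy \<Psi> Bs =
    (let l = Inf (last Bs); r = Sup (last Bs); m = (l + r) / 2 in
     if \<Psi> Bs {l..m} \<le> \<Psi> Bs {m..r} then {l..m} else {m..r})"

lemma strategy_A_halving: "strategy_A (1 / 2) (halving_strategy \<Psi>)"
  unfolding strategy_A_def
proof (intro allI impI, elim conjE)
  fix Bs :: "real set list"
  assume "closed_interval (last Bs)"
  then obtain l r where lr: "l < r" "last Bs = {l..r}"
    unfolding closed_interval_def by blast
  have m: "l < (l + r) / 2" "(l + r) / 2 < r" using lr by auto
  have "closed_interval {l..(l + r) / 2}" "closed_interval {(l + r) / 2..r}"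
    using m unfolding closed_interval_def by blast+
  then show "subinterval_ratio (1 / 2) (last Bs) (halving_strategy \<Psi> Bs)"
    using lr m unfolding halving_strategy_def subinterval_ratio_def
    by (auto simp: Let_def field_simps)
qed

lemma halving_strategy_potential:
  assumes "last Bs = {l..r}" "l < r"
  shows "2 * potential Z h lev s Bs (halving_strategy (potential Z h lev s) Bs)
    \<le> potential Z h lev s Bs (last Bs)"
proof -
  have m: "l < (l + r) / 2" "(l + r) / 2 < r" using assms by auto
  show ?thesis
    using potential_halves[OF m, of Z h lev s Bs] assms
    unfolding halving_strategy_def
    by (auto simp: Let_def mult_2 intro: order_trans[OF add_mono, rotated])
qed

lemma closed_interval_shrinking_Inter:
  fixes B :: "nat \<Rightarrow> real set"
  assumes int: "\<And>n. closed_interval (B n)" and dec: "\<And>n. B (Suc n) \<subseteq> B n"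
    and len: "(\<lambda>n. measure lborel (B n)) \<longlonglongrightarrow> 0"
  shows "\<exists>x. (\<Inter>n. B n) = {x}"
proof -
  have mono: "\<And>m n. m \<le> n \<Longrightarrow> B n \<subseteq> B m"
    using dec by (rule lift_Suc_antimono_le)
  have meas: "\<exists>l r. l < r \<and> B n = {l..r} \<and> measure lborel (B n) = r - l" for n
    using int[of n] unfolding closed_interval_def by force
  have small: "\<exists>n. \<forall>x\<in>B n. \<forall>y\<in>B n. dist x y < e" if "e > 0" for e
  proof -
    from LIMSEQ_D[OF len that] obtain n where "norm (measure lborel (B n) - 0) < e" by blast
    moreover obtain l r where "l < r" "B n = {l..r}" "measure lborel (B n) = r - l"
      using meas by blast
    ultimately show ?thesis
      by (intro exI[of _ n]) (auto simp: dist_real_def)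
  qed
  have "closed (B n)" "B n \<noteq> {}" for n
    using meas[of n] by auto
  then show ?thesis
    by (intro decreasing_closed_nest_sing) (use mono small in blast)+
qed

text \<open>Each \<open>Z \<kappa>\<close> is \<open>clumped\<close>: it looks like a set of diameter \<open>h \<kappa>\<close> in any interval of length
  \<open>\<l> \<kappa>\<close>. The weight condition concerns the clumps that player A has to mark in one round.\<close>

definition clump_cover ::
    "real \<Rightarrow> real \<Rightarrow> real \<Rightarrow> real set \<Rightarrow> ('k \<Rightarrow> real set) \<Rightarrow> ('k \<Rightarrow> real) \<Rightarrow> ('k \<Rightarrow> real) \<Rightarrow> bool" where
  "clump_cover \<rho> s L U Z \<l> h \<longleftrightarrow>
    (\<forall>\<kappa>. 0 < h \<kappa> \<and> h \<kappa> \<le> \<rho> * \<l> \<kappa> \<and> (Z \<kappa> \<noteq> {} \<longrightarrow> \<l> \<kappa> < L)) \<and>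
    (\<forall>\<kappa>. \<forall>x\<in>Z \<kappa>. \<forall>y\<in>Z \<kappa>. \<bar>x - y\<bar> \<le> \<l> \<kappa> \<longrightarrow> \<bar>x - y\<bar> \<le> h \<kappa>) \<and>
    (\<forall>r>0. (\<integral>\<^sup>+\<kappa>. (if r \<le> \<l> \<kappa> \<and> \<l> \<kappa> < r / \<rho> then ennreal ((h \<kappa> / \<l> \<kappa>) powr s) else 0)
       \<partial>count_space UNIV) \<le> ennreal (1 / 48)) \<and>
    U \<subseteq> (\<Union>\<kappa>. Z \<kappa>)"

lemma clump_coverD:
  assumes "clump_cover \<rho> s L U Z \<l> h"
  shows "0 < h \<kappa>" "h \<kappa> \<le> \<rho> * \<l> \<kappa>" "Z \<kappa> \<noteq> {} \<Longrightarrow> \<l> \<kappa> < L"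
    "x \<in> Z \<kappa> \<Longrightarrow> y \<in> Z \<kappa> \<Longrightarrow> \<bar>x - y\<bar> \<le> \<l> \<kappa> \<Longrightarrow> \<bar>x - y\<bar> \<le> h \<kappa>"
    "0 < r \<Longrightarrow> (\<integral>\<^sup>+\<kappa>. (if r \<le> \<l> \<kappa> \<and> \<l> \<kappa> < r / \<rho> then ennreal ((h \<kappa> / \<l> \<kappa>) powr s) else 0)
       \<partial>count_space UNIV) \<le> ennreal (1 / 48)"
    "U \<subseteq> (\<Union>\<kappa>. Z \<kappa>)"
  using assms unfolding clump_cover_def by simp_all

text \<open>The invariant is that the potential stays below |B_n|^s / 2. A's choice leaves |B_n|^s /
  4, which is 3/8 of |B_(n+1)|^s because one round multiplies |B_n|^s by 2/3; the new marks add at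
  most 4 * 3/2 * 1/48 = 1/8. If the limit point lay in a clump, then in the last round with h <
  |B_n| an end of the clump would lie in B_n and contribute h^s, at least 2/3 of |B_n|^s.\<close>

lemma game_winning_avoid_clumps:
  assumes \<beta>: "0 < \<beta>" "\<beta> < 1" and s: "0 < s" "(\<beta> / 2) powr s = 2 / 3"
    and clumps: "\<And>L. 0 < L \<Longrightarrow>
      \<exists>(Z :: 'k \<Rightarrow> real set) \<l> h. clump_cover (\<beta> / 2) s L ({a..b} - X) Z \<l> h"
    and X: "X \<subseteq> {a..b}"
  shows "game_winning {a..b} (1 / 2) \<beta> X"
proof -
  have "\<forall>L. \<exists>F :: ('k \<Rightarrow> real set) \<times> ('k \<Rightarrow> real) \<times> ('k \<Rightarrow> real). 0 < L \<longrightarrow>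
      clump_cover (\<beta> / 2) s L ({a..b} - X) (fst F) (fst (snd F)) (snd (snd F))"
    using clumps by fastforce
  then obtain F :: "real \<Rightarrow> ('k \<Rightarrow> real set) \<times> ('k \<Rightarrow> real) \<times> ('k \<Rightarrow> real)" where
    F: "\<And>L. 0 < L \<Longrightarrow> clump_cover (\<beta> / 2) s L ({a..b} - X) (fst (F L)) (fst (snd (F L))) (snd (snd (F L)))"
    by metis
  define Z where "Z = (\<lambda>L. fst (F L))"
  define \<l> where "\<l> = (\<lambda>L. fst (snd (F L)))"
  define h where "h = (\<lambda>L. snd (snd (F L)))"
  have F': "clump_cover (\<beta> / 2) s L ({a..b} - X) (Z L) (\<l> L) (h L)" if "0 < L" for L
    using F[OF that] by (simp add: Z_def \<l>_def h_def)
  define \<rho> where "\<rho> = \<beta> / 2"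
  have \<rho>: "0 < \<rho>" "\<rho> < 1" "\<rho> powr s = 2 / 3" using \<beta> s by (auto simp: \<rho>_def)
  \<comment> \<open>The first round whose interval is no longer than \<open>\<l> L \<kappa>\<close>:
    from then on the clump looks like a set of diameter \<open>h L \<kappa>\<close>.\<close>
  define lev where "lev = (\<lambda>L \<kappa>. LEAST n. L * \<rho> ^ n \<le> \<l> L \<kappa>)"
  \<comment> \<open>The choice of clumps depends on the length of B's first interval, which the
    history supplies.\<close>
  define pot where "pot = (\<lambda>Bs. let L = measure lborel (hd Bs) in potential (Z L) (h L) (lev L) s Bs)"
  define \<sigma> where "\<sigma> = halving_strategy pot"
  have "\<exists>x\<in>X. (\<Inter>n. B n) = {x}" if B: "legal_B {a..b} \<beta> \<sigma> B" for B
  proof -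
    define H where "H = (\<lambda>n. map B [0..<Suc n])"
    have HS: "H (Suc n) = H n @ [B (Suc n)]" for n by (simp add: H_def)
    have H: "H n \<noteq> []" "last (H n) = B n" "length (H n) = Suc n" for n
      by (auto simp: H_def)
    have hd: "hd (H n) = B 0" for n
    proof (induction n)
      case (Suc n)
      then show ?case using H(1)[of n] by (simp add: HS)
    qed (simp add: H_def)
    have B0: "closed_interval (B 0)" "B 0 \<subseteq> {a..b}"
      and Bsub: "subinterval_ratio \<beta> (\<sigma> (H n)) (B (Suc n))" for n
      using B unfolding legal_B_def H_def by auto
    have int: "closed_interval (B n)" for n
      using B0 Bsub by (cases n) (auto simp: subinterval_ratio_def)
    have \<sigma>sub: "subinterval_ratio (1 / 2) (B n) (\<sigma> (H n))" for n
      using strategy_A_halving[of pot, unfolded strategy_A_def, rule_format, of "H n"] H[of n] int[of n]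
      by (simp add: \<sigma>_def)
    have dec: "B (Suc n) \<subseteq> B n" for n
      using Bsub[of n] \<sigma>sub[of n] unfolding subinterval_ratio_def by blast
    have mono: "\<And>m n. m \<le> n \<Longrightarrow> B n \<subseteq> B m"
      using dec by (rule lift_Suc_antimono_le)
    define L where "L = measure lborel (B 0)"
    have len: "measure lborel (B n) = L * \<rho> ^ n" for n
    proof (induction n)
      case (Suc n)
      then show ?case
        using Bsub[of n] \<sigma>sub[of n] unfolding subinterval_ratio_def \<rho>_def by simp
    qed (simp add: L_def)
    obtain l0 r0 where lr0: "l0 < r0" "B 0 = {l0..r0}" using int unfolding closed_interval_def by blast
    have L: "0 < L" using lr0 by (simp add: L_def)
    have ends: "\<exists>l r. l < r \<and> B n = {l..r} \<and> r - l = L * \<rho> ^ n" for n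
      using int[of n] len[of n] unfolding closed_interval_def by force
    note D = clump_coverD[OF F'[OF L, folded \<rho>_def]]
    note hpos = D(1) and hl = D(2) and lL = D(3) and clump = D(4) and weight = D(5) and cover = D(6)
    define z where "z = Z L"
    define \<Psi> where "\<Psi> = potential z (h L) (lev L) s"
    have lim: "(\<lambda>n. L * \<rho> ^ n) \<longlonglongrightarrow> 0"
      using \<rho> by (auto intro!: tendsto_eq_intros LIMSEQ_power_zero)
    have lpos: "0 < \<l> L \<kappa>" for \<kappa>
      using less_le_trans[OF hpos[of \<kappa>] hl[of \<kappa>]] \<rho> by (simp add: zero_less_mult_iff)
    have Lex: "\<exists>n. L * \<rho> ^ n \<le> e" if "e > 0" for e
    proof -
      obtain n where "norm (L * \<rho> ^ n - 0) < e" using LIMSEQ_D[OF lim \<open>e > 0\<close>] by blast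
      then show ?thesis by (intro exI[of _ n]) auto
    qed
    have lev1: "L * \<rho> ^ lev L \<kappa> \<le> \<l> L \<kappa>" for \<kappa>
      unfolding lev_def by (rule LeastI_ex[OF Lex[OF lpos]])
    have lev2: "\<l> L \<kappa> < L * \<rho> ^ n" if "lev L \<kappa> = Suc n" for \<kappa> n
    proof -
      have "n < lev L \<kappa>" using that by simp
      then have "\<not> L * \<rho> ^ n \<le> \<l> L \<kappa>" unfolding lev_def by (rule not_less_Least)
      then show ?thesis by auto
    qed
    have lev0: "Z L \<kappa> = {}" if "lev L \<kappa> = 0" for \<kappa>
      using lev1[of \<kappa>] lL[of \<kappa>] that by auto
    have powL: "(L * \<rho> ^ n) powr s = L powr s * (2/3) ^ n" for n
    proof -
      have "(\<rho> ^ n) powr s = (\<rho> powr s) ^ n"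
        using \<rho>(1) by (induction n) (auto simp: powr_mult)
      then show ?thesis using L \<rho> by (simp add: powr_mult)
    qed
    have new: "(\<integral>\<^sup>+\<kappa>. (if lev L \<kappa> = Suc n then ennreal (h L \<kappa> powr s) else 0) \<partial>count_space UNIV)
        \<le> ennreal ((3/2) * (L * \<rho> ^ Suc n) powr s) * ennreal (1 / 48)" for n
    proof -
      \<comment> \<open>Being marked in round \<open>Suc n\<close> puts the length into the window
        from \<open>r\<close> to \<open>r / \<rho>\<close> of the weight condition; the factor 3/2
        is \<rho> to the power -s.\<close>
      define r where "r = L * \<rho> ^ Suc n"
      have r: "0 < r" "r / \<rho> = L * \<rho> ^ n" using L \<rho> by (auto simp: r_def)
      have "(\<integral>\<^sup>+\<kappa>. (if lev L \<kappa> = Suc n then ennreal (h L \<kappa> powr s) else 0) \<partial>count_space UNIV)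
         \<le> (\<integral>\<^sup>+\<kappa>. ennreal ((3/2) * r powr s) * (if r \<le> \<l> L \<kappa> \<and> \<l> L \<kappa> < r / \<rho>
         then ennreal ((h L \<kappa> / \<l> L \<kappa>) powr s) else 0) \<partial>count_space UNIV)"
      proof (intro nn_integral_mono)
        fix \<kappa>
        have "h L \<kappa> powr s \<le> 3/2 * r powr s * (h L \<kappa> / \<l> L \<kappa>) powr s" if lv: "lev L \<kappa> = Suc n"
        proof -
          have "\<l> L \<kappa> \<le> r / \<rho>" using lev2[OF lv] r by auto
          then have "\<l> L \<kappa> powr s \<le> (r / \<rho>) powr s" using lpos[of \<kappa>] s by (intro powr_mono2) auto
          also have "\<dots> = 3/2 * r powr s" unfolding powr_divide \<rho>(3) by simp
          finally have "(h L \<kappa> / \<l> L \<kappa>) powr s * \<l> L \<kappa> powr s \<le> (h L \<kappa> / \<l> L \<kappa>) powr s * (3/2 * r powr s)"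
            by (rule mult_left_mono) simp
          moreover have "(h L \<kappa> / \<l> L \<kappa>) powr s * \<l> L \<kappa> powr s = h L \<kappa> powr s"
            using lpos[of \<kappa>] hpos[of \<kappa>] by (simp add: powr_divide)
          ultimately show ?thesis by (metis mult.commute)
        qed
        moreover have "r \<le> \<l> L \<kappa> \<and> \<l> L \<kappa> < r / \<rho>" if "lev L \<kappa> = Suc n"
          using lev1[of \<kappa>] lev2[OF that] that r by (auto simp: r_def)
        ultimately show "(if lev L \<kappa> = Suc n then ennreal (h L \<kappa> powr s) else 0) \<le>
            ennreal ((3/2) * r powr s) * (if r \<le> \<l> L \<kappa> \<and> \<l> L \<kappa> < r / \<rho>
              then ennreal ((h L \<kappa> / \<l> L \<kappa>) powr s) else 0)"
          by (auto simp: ennreal_mult[symmetric] intro!: ennreal_leI)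
      qed
      also have "\<dots> \<le> ennreal ((3/2) * r powr s) * ennreal (1 / 48)"
        by (subst nn_integral_cmult) (auto intro!: mult_left_mono weight r)
      finally show ?thesis by (simp add: r_def)
    qed
    have inv: "\<Psi> (H n) (B n) \<le> ennreal ((1/2) * (L * \<rho> ^ n) powr s)" for n
    proof (induction n)
      case 0
      have "\<not> (lev L \<kappa> < length (H 0) \<and> z \<kappa> \<inter> H 0 ! lev L \<kappa> \<noteq> {})" for \<kappa>
        using lev0[of \<kappa>] H(3)[of 0] by (cases "lev L \<kappa>") (auto simp: z_def)
      then have "\<Psi> (H 0) (B 0) = 0"
        unfolding \<Psi>_def potential_def by (simp only: if_False) simp
      then show ?case by simp
    next
      case (Suc n)
      obtain l r where "l < r" "last (H n) = {l..r}" using ends[of n] H by auto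
      then have half: "2 * \<Psi> (H n) (\<sigma> (H n)) \<le> \<Psi> (H n) (B n)"
        using halving_strategy_potential[of "H n" l r z "h L" "lev L" s] H[of n] hd[of n]
        unfolding \<sigma>_def \<Psi>_def halving_strategy_def pot_def L_def z_def Let_def by simp
      have "\<Psi> (H (Suc n)) (B (Suc n)) \<le> \<Psi> (H n) (B (Suc n)) + 
          4 * (\<integral>\<^sup>+\<kappa>. (if lev L \<kappa> = Suc n then ennreal (h L \<kappa> powr s) else 0) \<partial>count_space UNIV)"
        unfolding \<Psi>_def HS using potential_extend[of z "h L" "lev L" s "H n" "B (Suc n)"] H by simp
      also have "\<dots> \<le> \<Psi> (H n) (\<sigma> (H n)) + 4 * (ennreal ((3/2) * (L * \<rho> ^ Suc n) powr s) * ennreal (1 / 48))"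
        using new[of n] Bsub[of n] unfolding \<Psi>_def subinterval_ratio_def
        by (intro add_mono mult_left_mono potential_mono) auto
      finally have 1: "\<Psi> (H (Suc n)) (B (Suc n)) \<le> \<Psi> (H n) (\<sigma> (H n)) + ennreal ((1/8) * (L * \<rho> ^ Suc n) powr s)"
        by (simp add: ennreal_mult[symmetric] flip: ennreal_numeral)
      have fin: "2 * \<Psi> (H n) (\<sigma> (H n)) \<le> ennreal ((1/2) * (L * \<rho> ^ n) powr s)"
        using half Suc by (rule order_trans)
      have "\<Psi> (H n) (\<sigma> (H n)) < top"
        using fin by (cases "\<Psi> (H n) (\<sigma> (H n))") (auto simp: ennreal_mult_top top_unique)
      then obtain y where y: "y \<ge> 0" "\<Psi> (H n) (\<sigma> (H n)) = ennreal y"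
        by (cases "\<Psi> (H n) (\<sigma> (H n))") auto
      have "2 * y \<le> (1/2) * (L * \<rho> ^ n) powr s"
        using fin y by (simp add: ennreal_mult[symmetric] flip: ennreal_numeral)
      then have "y + (1/8) * (L * \<rho> ^ Suc n) powr s \<le> (1/2) * (L * \<rho> ^ Suc n) powr s"
        unfolding powL by simp
      then have le: "ennreal y + ennreal ((1/8) * (L * \<rho> ^ Suc n) powr s) \<le> ennreal ((1/2) * (L * \<rho> ^ Suc n) powr s)"
        using y(1) by (metis (no_types, lifting) ennreal_leI ennreal_plus powr_ge_zero
            mult_nonneg_nonneg zero_le_divide_1_iff zero_le_numeral)
      show ?case by (rule order_trans[OF 1[unfolded y(2)] le])
    qed
    obtain x where x: "(\<Inter>n. B n) = {x}"
      using closed_interval_shrinking_Inter[of B] int dec lim len by auto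
    then have xB: "x \<in> B n" for n by blast
    have "x \<in> X"
    proof (rule ccontr)
      assume "x \<notin> X"
      then obtain \<kappa> where \<kappa>: "x \<in> z \<kappa>" using cover xB[of 0] B0 unfolding z_def by blast
      define m where "m = lev L \<kappa>"
      define S where "S = z \<kappa> \<inter> B m"
      have xS: "x \<in> S" using \<kappa> xB by (simp add: S_def)
      obtain lm rm where lm: "lm < rm" "B m = {lm..rm}" "rm - lm = L * \<rho> ^ m" using ends by blast
      have Sl: "S \<subseteq> {lm..rm}" using lm by (auto simp: S_def)
      have bdd: "bdd_above S" "bdd_below S" using Sl by (auto intro: bdd_above_mono bdd_below_mono)
      have diam: "\<bar>y - y'\<bar> \<le> h L \<kappa>" if "y \<in> S" "y' \<in> S" for y y'
      proof (rule clump)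
        show "y \<in> Z L \<kappa>" "y' \<in> Z L \<kappa>" using that by (auto simp: S_def z_def)
        have "y \<in> {lm..rm}" "y' \<in> {lm..rm}" using that Sl by auto
        then have "\<bar>y - y'\<bar> \<le> rm - lm" by auto
        then show "\<bar>y - y'\<bar> \<le> \<l> L \<kappa>" using lm lev1[of \<kappa>] by (simp add: m_def)
      qed
      have "Sup S \<le> y + h L \<kappa>" if "y \<in> S" for y
      proof (rule cSup_least)
        show "y' \<le> y + h L \<kappa>" if "y' \<in> S" for y' using diam[OF that \<open>y \<in> S\<close>] by linarith
      qed (use xS in blast)
      then have "Sup S - h L \<kappa> \<le> Inf S"
        using xS by (intro cInf_greatest) (auto simp: algebra_simps)
      have xlo: "Inf S \<le> x" "x \<le> Sup S" using xS bdd by (auto intro: cInf_lower cSup_upper)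
      \<comment> \<open>In the round before \<open>N\<close> the interval is still longer than the
        clump. It contains \<open>x\<close>, which lies between the two ends, so it cannot miss both
        of them.\<close>
      define N where "N = (LEAST n. L * \<rho> ^ n \<le> h L \<kappa>)"
      have N: "L * \<rho> ^ N \<le> h L \<kappa>" unfolding N_def by (rule LeastI_ex[OF Lex[OF hpos]])
      have "Z L \<kappa> \<noteq> {}" using \<kappa> by (auto simp: z_def)
      then have "lev L \<kappa> \<noteq> 0" using lev0 by blast
      then obtain m' where m': "m = Suc m'" unfolding m_def by (metis not0_implies_Suc)
      have lm': "\<l> L \<kappa> < L * \<rho> ^ m'" using lev2[of \<kappa> m'] m' m_def by simp
      have "h L \<kappa> \<le> \<rho> * \<l> L \<kappa>" by (rule hl)
      also have "\<dots> < \<rho> * (L * \<rho> ^ m')" using lm' \<rho> by (intro mult_strict_left_mono) auto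
      also have "\<dots> = L * \<rho> ^ m" using m' by simp
      finally have hm: "h L \<kappa> < L * \<rho> ^ m" .
      \<comment> \<open>The margin \<open>h \<le> \<rho> * \<l>\<close> ensures that the ends were
        marked before the interval shrinks to the size of the clump.\<close>
      have mN: "m < N"
      proof (rule ccontr)
        assume "\<not> m < N"
        then have "\<rho> ^ m \<le> \<rho> ^ N" using \<rho> by (intro power_decreasing) auto
        then have "L * \<rho> ^ m \<le> L * \<rho> ^ N" using L by simp
        then show False using hm N by simp
      qed
      then obtain n where n: "N = Suc n" "m \<le> n" by (cases N) auto
      then have "n < N" by simp
      then have hn: "h L \<kappa> < L * \<rho> ^ n" unfolding N_def using not_less_Least by (meson not_le)
      obtain l r where lr: "l < r" "B n = {l..r}" "r - l = L * \<rho> ^ n" using ends by blast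
      have "Inf S \<in> B n \<or> Sup S \<in> B n"
        using xB[of n] lr hn xlo \<open>Sup S - h L \<kappa> \<le> Inf S\<close> by auto
      then have one: "1 \<le> endpoint_count (Inf S) (B n) + endpoint_count (Sup S) (B n)"
        using endpoint_count_ge by (metis add_increasing add_increasing2 zero_le)
      have "ennreal (h L \<kappa> powr s) * 1 \<le>
          ennreal (h L \<kappa> powr s) * (endpoint_count (Inf S) (B n) + endpoint_count (Sup S) (B n))"
        using one by (intro mult_left_mono) auto
      also have "\<dots> \<le> \<Psi> (H n) (B n)"
      proof -
        have "H n ! m = B m" using n by (simp add: H_def nth_append del: upt_Suc)
        moreover have "m < length (H n)" using n H by simp
        ultimately show ?thesis
          using potential_ge_term[of "lev L" \<kappa> "H n" z "h L" s "B n"] xS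
          unfolding \<Psi>_def S_def m_def by auto
      qed
      also have "\<dots> \<le> ennreal ((1/2) * (L * \<rho> ^ n) powr s)" by (rule inv)
      finally have "h L \<kappa> powr s \<le> (1/2) * (L * \<rho> ^ n) powr s" by simp
      moreover have "(L * \<rho> ^ N) powr s \<le> h L \<kappa> powr s"
        using N s L \<rho> by (intro powr_mono2) auto
      ultimately have "(L * \<rho> ^ N) powr s \<le> (1/2) * (L * \<rho> ^ n) powr s" by simp
      then have "2/3 * (L powr s * (2/3) ^ n) \<le> 1/2 * (L powr s * (2/3) ^ n)"
        unfolding powL n by simp
      moreover have "0 < L powr s * (2/3) ^ n" using L by simp
      ultimately show False by linarith
    qed
    then show ?thesis using x by blast
  qed
  moreover have "strategy_A (1 / 2) \<sigma>" unfolding \<sigma>_def by (rule strategy_A_halving)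
  ultimately show ?thesis using X unfolding game_winning_def by blast
qed

subsection \<open>Counting clumps\<close>

text \<open>\<open>K\<close> steps of the progression lose at least the factor
  \<open>\<rho>\<close>, so at most \<open>K + 1\<close> indices fall into the window.\<close>

lemma nn_integral_window_le:
  fixes C \<theta> r \<rho> w :: real
  assumes "0 < C" "0 < \<theta>" "\<theta> \<le> 1 / 2" "0 < r" and K: "(1 / 2) ^ K \<le> \<rho>" and "0 < \<rho>"
  shows "(\<integral>\<^sup>+u. (if r \<le> C * \<theta> ^ u \<and> C * \<theta> ^ u < r / \<rho> then ennreal w else 0) \<partial>count_space UNIV)
    \<le> of_nat (K + 1) * ennreal w"
proof -
  define A where "A = {u. r \<le> C * \<theta> ^ u \<and> C * \<theta> ^ u < r / \<rho>}"
  have close: "v \<le> u + K" if "u \<in> A" "v \<in> A" for u v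
  proof (rule ccontr)
    assume "\<not> v \<le> u + K"
    then have "C * \<theta> ^ v \<le> C * \<theta> ^ (u + K)"
      using assms by (intro mult_left_mono power_decreasing) auto
    also have "\<dots> = C * \<theta> ^ u * \<theta> ^ K" by (simp add: power_add)
    also have "\<dots> \<le> C * \<theta> ^ u * \<rho>"
      using assms by (intro mult_left_mono order_trans[OF power_mono K]) auto
    also have "\<dots> < r" using that assms by (auto simp: A_def field_simps)
    also have "r \<le> C * \<theta> ^ v" using that by (auto simp: A_def)
    finally show False by simp
  qed
  have card: "finite A \<and> card A \<le> K + 1"
  proof (cases "A = {}")
    case False
    define u where "u = (LEAST u. u \<in> A)"
    have "u \<in> A" using False unfolding u_def by (metis LeastI ex_in_conv)
    then have "A \<subseteq> {u..u + K}"
      using close by (auto simp: u_def intro: Least_le)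
    then show ?thesis using finite_subset card_mono[of "{u..u + K}" A] by auto
  qed auto
  have "(\<integral>\<^sup>+u. (if r \<le> C * \<theta> ^ u \<and> C * \<theta> ^ u < r / \<rho> then ennreal w else 0) \<partial>count_space UNIV)
     = (\<integral>\<^sup>+u. ennreal w * indicator A u \<partial>count_space UNIV)"
    by (intro nn_integral_cong) (auto simp: A_def)
  also have "\<dots> = ennreal w * of_nat (card A)"
    using card by (simp add: nn_integral_cmult emeasure_count_space)
  also have "\<dots> \<le> ennreal w * of_nat (K + 1)"
    using card by (intro mult_left_mono) (simp_all only: of_nat_le_iff zero_le)
  finally show ?thesis by (simp add: mult.commute)
qed

lemma nn_integral_geometric:
  assumes "0 \<le> \<tau>" "\<tau> < (1::real)"
  shows "(\<integral>\<^sup>+k. ennreal (\<tau> ^ k) \<partial>count_space UNIV) = ennreal (1 / (1 - \<tau>))"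
  using assms
  by (subst nn_integral_count_space_nat)
     (intro suminf_ennreal_eq; auto simp: geometric_sums)

lemma nn_integral_geometric3:
  assumes "0 \<le> \<tau>" "\<tau> < (1::real)" "0 \<le> c"
  shows "(\<integral>\<^sup>+(k, b, e). ennreal (c * \<tau> ^ (k + b + e)) \<partial>count_space (UNIV :: (nat \<times> nat \<times> nat) set))
    = ennreal (c * (1 / (1 - \<tau>)) ^ 3)"
proof -
  let ?G = "ennreal (1 / (1 - \<tau>))"
  have "(\<integral>\<^sup>+(k, b, e). ennreal (c * \<tau> ^ (k + b + e)) \<partial>count_space (UNIV :: (nat \<times> nat \<times> nat) set))
     = (\<integral>\<^sup>+k. \<integral>\<^sup>+b. \<integral>\<^sup>+e. ennreal c * ennreal (\<tau> ^ k) * ennreal (\<tau> ^ b) * ennreal (\<tau> ^ e)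
          \<partial>count_space UNIV \<partial>count_space UNIV \<partial>count_space UNIV)"
    using assms
    by (simp add: nn_integral_fst_count_space[symmetric] power_add ennreal_mult[symmetric] mult.assoc)
  also have "\<dots> = ennreal c * ?G * ?G * ?G"
    using nn_integral_geometric[OF assms(1,2)]
    by (simp add: nn_integral_cmult nn_integral_multc)
  finally show ?thesis using assms
    by (simp add: ennreal_mult[symmetric] power3_eq_cube mult.assoc)
qed

text \<open>\<open>Y\<close> must be found before the scales \<open>C\<close>, which later depend on
  it through the constants of the arc; hence the uniformity in \<open>C\<close>,
  \<open>\<theta>\<close> and \<open>r\<close>. The factor Y^(-s) beats the number of indices
  \<open>u\<close> in a window and the three geometric sums.\<close>

lemma clump_weight:
  fixes \<rho> s \<nu> T :: real
  assumes \<rho>: "0 < \<rho>" and s: "0 < s" and \<nu>: "0 < \<nu>"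
  obtains Y where "T \<le> Y" "0 < Y"
    "\<And>(C :: nat \<times> nat \<times> nat \<Rightarrow> real) \<theta> r. \<lbrakk>\<And>g. 0 < C g; 0 < \<theta>; \<theta> \<le> 1 / 2; 0 < r\<rbrakk> \<Longrightarrow>
      (\<integral>\<^sup>+(u, k, b, e). (if r \<le> C (k, b, e) * \<theta> ^ u \<and> C (k, b, e) * \<theta> ^ u < r / \<rho>
        then ennreal ((1 / (Y * 2 powr (\<nu> * real (k + b + e)))) powr s) else 0) \<partial>count_space UNIV)
      \<le> ennreal (1 / 48)"
proof -
  define \<tau> where "\<tau> = (2::real) powr - (\<nu> * s)"
  have \<tau>: "0 \<le> \<tau>" "\<tau> < 1" using s \<nu> by (auto simp: \<tau>_def powr_less_one)
  obtain K where K: "(1 / 2) ^ K < \<rho>"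
    using real_arch_pow_inv[OF \<rho>, of "1 / 2"] by auto
  define M where "M = 48 * ((real K + 1) * (1 / (1 - \<tau>)) ^ 3)"
  have M: "0 < M" using \<tau> by (auto simp: M_def intro!: mult_pos_pos)
  define Y where "Y = max T (M powr (1 / s))"
  have Y: "T \<le> Y" "0 < Y" using M by (auto simp: Y_def less_max_iff_disj)
  define M' where "M' = Y powr s"
  have "(M powr (1 / s)) powr s \<le> M'"
    unfolding M'_def using s by (intro powr_mono2) (auto simp: Y_def)
  then have M': "M \<le> M'" "0 < M'" using M s by (auto simp: powr_powr)
  show ?thesis
  proof (rule that[OF Y])
    fix C :: "nat \<times> nat \<times> nat \<Rightarrow> real" and \<theta> r :: real
    assume C: "\<And>g. 0 < C g" and \<theta>: "0 < \<theta>" "\<theta> \<le> 1 / 2" and r: "0 < r"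
    let ?w = "\<lambda>k b e :: nat. (1 / (Y * 2 powr (\<nu> * real (k + b + e)))) powr s"
    have w: "?w k b e = 1 / M' * \<tau> ^ (k + b + e)" for k b e
    proof -
      have "((2::real) powr (\<nu> * real n)) powr s = 1 / \<tau> ^ n" for n
        by (simp add: \<tau>_def powr_powr powr_minus field_simps flip: powr_realpow)
      then show ?thesis by (simp only: powr_divide powr_mult M'_def[symmetric]) simp
    qed
    have "(\<integral>\<^sup>+(u, k, b, e). (if r \<le> C (k, b, e) * \<theta> ^ u \<and> C (k, b, e) * \<theta> ^ u < r / \<rho>
        then ennreal (?w k b e) else 0) \<partial>count_space UNIV)
      = (\<integral>\<^sup>+(k, b, e). \<integral>\<^sup>+u. (if r \<le> C (k, b, e) * \<theta> ^ u \<and> C (k, b, e) * \<theta> ^ u < r / \<rho>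
        then ennreal (?w k b e) else 0) \<partial>count_space UNIV \<partial>count_space UNIV)"
      by (subst nn_integral_snd_count_space[symmetric], rule nn_integral_cong) (auto split: prod.split)
    also have "\<dots> \<le> (\<integral>\<^sup>+(k, b, e). ennreal ((real K + 1) / M' * \<tau> ^ (k + b + e)) \<partial>count_space UNIV)"
    proof (intro nn_integral_mono, clarsimp simp only: split: prod.split)
      fix k b e :: nat
      have "(\<integral>\<^sup>+u. (if r \<le> C (k, b, e) * \<theta> ^ u \<and> C (k, b, e) * \<theta> ^ u < r / \<rho>
        then ennreal (?w k b e) else 0) \<partial>count_space UNIV) \<le> of_nat (K + 1) * ennreal (?w k b e)"
        using K \<rho> C \<theta> r by (intro nn_integral_window_le) auto
      also have "\<dots> = ennreal ((real K + 1) / M' * \<tau> ^ (k + b + e))"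
        unfolding w using M' \<tau>
        by (subst ennreal_of_nat_eq_real_of_nat)
          (simp add: ennreal_mult[symmetric] add.commute del: ennreal_plus)
      finally show "(\<integral>\<^sup>+u. (if r \<le> C (k, b, e) * \<theta> ^ u \<and> C (k, b, e) * \<theta> ^ u < r / \<rho>
        then ennreal (?w k b e) else 0) \<partial>count_space UNIV) \<le> ennreal ((real K + 1) / M' * \<tau> ^ (k + b + e))" .
    qed
    also have "\<dots> = ennreal ((real K + 1) / M' * (1 / (1 - \<tau>)) ^ 3)"
      using \<tau> M' by (intro nn_integral_geometric3) auto
    also have "\<dots> \<le> ennreal (1 / 48)"
      using M' \<tau> unfolding M_def by (intro ennreal_leI) (simp add: field_simps)
    finally show "(\<integral>\<^sup>+(u, k, b, e). (if r \<le> C (k, b, e) * \<theta> ^ u \<and> C (k, b, e) * \<theta> ^ u < r / \<rho>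
        then ennreal (?w k b e) else 0) \<partial>count_space UNIV) \<le> ennreal (1 / 48)" .
  qed
qed

subsection \<open>Lines through a rational point and mean value estimates\<close>

lemma line_through_rational_point:
  fixes q p r :: int and i j :: real
  assumes q: "1 \<le> q" and ij: "0 \<le> i" "0 \<le> j" "i + j = 1"
  shows "\<exists>A B C :: int. (A \<noteq> 0 \<or> B \<noteq> 0) \<and> \<bar>real_of_int A\<bar> \<le> q powr i \<and> \<bar>real_of_int B\<bar> \<le> q powr j
    \<and> A * p + B * r + C * q = 0"
proof -
  define S where "S = {0..\<lfloor>q powr i\<rfloor>} \<times> {0..\<lfloor>q powr j\<rfloor>}"
  define g where "g = (\<lambda>(A, B). (A * p + B * r) mod q)"
  have fl: "0 \<le> \<lfloor>q powr e\<rfloor>" for e by simp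
  have "card S = nat (\<lfloor>q powr i\<rfloor> + 1) * nat (\<lfloor>q powr j\<rfloor> + 1)" by (simp add: S_def)
  then have "real (card S) = (of_int \<lfloor>q powr i\<rfloor> + 1) * (of_int \<lfloor>q powr j\<rfloor> + 1)"
    using fl[of i] fl[of j] by (simp add: of_nat_nat)
  also have "\<dots> > q powr i * q powr j"
    \<comment> \<open>A floor plus 1 exceeds the number itself, so the box holds more than q^i q^j =
      q pairs, and two of them share a residue modulo q.\<close>
    using q by (intro mult_strict_mono) (auto intro!: add_nonneg_pos)
  also have "q powr i * q powr j = q" using q ij by (simp flip: powr_add)
  finally have "card S > card {0..<q}" using q by simp
  moreover have "g ` S \<subseteq> {0..<q}" using q by (auto simp: g_def)
  ultimately have "\<not> inj_on g S" by (metis card_inj_on_le finite_atLeastLessThan_int not_le)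
  then obtain A B A' B' where AB: "(A, B) \<in> S" "(A', B') \<in> S" "(A, B) \<noteq> (A', B')"
    "(A * p + B * r) mod q = (A' * p + B' * r) mod q"
    unfolding inj_on_def g_def by auto
  then have "q dvd (A * p + B * r) - (A' * p + B' * r)" by (simp add: mod_eq_dvd_iff)
  then obtain C where C: "(A * p + B * r) - (A' * p + B' * r) = q * C" by (auto simp: dvd_def)
  have "\<bar>real_of_int (A - A')\<bar> \<le> q powr i" "\<bar>real_of_int (B - B')\<bar> \<le> q powr j"
    using AB(1,2) unfolding S_def by (auto simp: abs_le_iff le_floor_iff)
  moreover have "(A - A') * p + (B - B') * r + (- C) * q = 0" using C by (simp add: algebra_simps)
  moreover have "A - A' \<noteq> 0 \<or> B - B' \<noteq> 0" using AB(3) by auto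
  ultimately show ?thesis by blast
qed

lemma mvt_within:
  fixes g g' :: "real \<Rightarrow> real"
  assumes d: "\<And>x. x \<in> {a..b} \<Longrightarrow> (g has_real_derivative g' x) (at x within {a..b})"
    and xy: "x \<in> {a..b}" "y \<in> {a..b}"
  obtains t where "t \<in> {a..b}" "min x y \<le> t" "t \<le> max x y" "g x - g y = g' t * (x - y)"
proof -
  have "\<exists>t\<in>{min x y..max x y}. g (max x y) - g (min x y) = g' t * (max x y - min x y)"
  proof (rule mvt_very_simple)
    show "(g has_derivative (*) (g' t)) (at t within {min x y..max x y})" if "min x y \<le> t" "t \<le> max x y" for t
      using xy that d[of t]
      by (auto simp: has_field_derivative_def min_def max_def split: if_splits
          intro: has_derivative_subset)
  qed simp
  then obtain t where t: "min x y \<le> t" "t \<le> max x y"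
    "g (max x y) - g (min x y) = g' t * (max x y - min x y)" by auto
  moreover have "g x - g y = g' t * (x - y)"
    using t(3) by (cases "x \<le> y") (auto simp: min_def max_def algebra_simps)
  ultimately show ?thesis using xy by (intro that[of t]) (auto simp: min_def max_def split: if_splits)
qed

lemma powr_le_self: "1 \<le> y \<Longrightarrow> e \<le> 1 \<Longrightarrow> y powr e \<le> (y::real)"
  using powr_mono[of e 1 y] by simp

lemma double_powr_le: "0 \<le> y \<Longrightarrow> 0 \<le> e \<Longrightarrow> e \<le> 1 \<Longrightarrow> (2 * y) powr e \<le> 2 * (y::real) powr e"
  using mult_right_mono[OF powr_le_self[of 2 e], of "y powr e"] by (simp add: powr_mult)

lemma abs_det_le:
  fixes x y z w :: real
  assumes "\<bar>x\<bar> \<le> a" "\<bar>y\<bar> \<le> b" "\<bar>z\<bar> \<le> c" "\<bar>w\<bar> \<le> d"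
  shows "\<bar>x * y - z * w\<bar> \<le> a * b + c * d"
proof -
  have "\<bar>x * y - z * w\<bar> \<le> \<bar>x\<bar> * \<bar>y\<bar> + \<bar>z\<bar> * \<bar>w\<bar>"
    by (metis abs_mult abs_triangle_ineq4)
  also have "\<dots> \<le> a * b + c * d"
    using assms by (intro add_mono mult_mono) auto
  finally show ?thesis .
qed

text \<open>Subtract \<kappa>/2 (t - u)^2, where u is the left point if g' is nonnegative there and
  the right point otherwise: the remaining function is monotone between the points in the needed
  direction. The sign condition excludes pairs on opposite sides of an extremum, where g may take
  equal values.\<close>

lemma quadratic_growth:
  fixes g g' g'' :: "real \<Rightarrow> real"
  assumes g: "\<And>x. x \<in> {a..b} \<Longrightarrow> (g has_real_derivative g' x) (at x within {a..b})"
    and g': "\<And>x. x \<in> {a..b} \<Longrightarrow> (g' has_real_derivative g'' x) (at x within {a..b})"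
    and \<kappa>: "\<And>x. x \<in> {a..b} \<Longrightarrow> \<kappa> \<le> g'' x"
    and xy: "x \<in> {a..b}" "y \<in> {a..b}"
    and side: "0 \<le> g' x \<and> 0 \<le> g' y \<or> g' x \<le> 0 \<and> g' y \<le> 0"
  shows "\<kappa> * (x - y)\<^sup>2 / 2 \<le> \<bar>g x - g y\<bar>"
proof -
  have main: "\<kappa> * (z - w)\<^sup>2 / 2 \<le> \<bar>g z - g w\<bar>"
    if zw: "w \<in> {a..b}" "z \<in> {a..b}" "w \<le> z" and sd: "0 \<le> g' w \<or> g' z \<le> 0" for z w
  proof -
    have inc: "\<kappa> * (t' - t) \<le> g' t' - g' t" if tt: "t \<in> {a..b}" "t' \<in> {a..b}" "t \<le> t'" for t t'
    proof -
      obtain \<xi> where "\<xi> \<in> {a..b}" "g' t' - g' t = g'' \<xi> * (t' - t)"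
        using mvt_within[OF g' tt(2,1)] by metis
      then show ?thesis using \<kappa> tt(3) by (auto intro: mult_right_mono)
    qed
    have d: "((\<lambda>t. g t - \<kappa> / 2 * (t - u)\<^sup>2) has_real_derivative g' t - \<kappa> * (t - u)) (at t within {a..b})"
      if "t \<in> {a..b}" for t u
      using g[OF that] by (auto intro!: derivative_eq_intros)
    show ?thesis
    proof (cases "0 \<le> g' w")
      case True
      obtain \<xi> where \<xi>: "\<xi> \<in> {a..b}" "min z w \<le> \<xi>"
        "(g z - \<kappa> / 2 * (z - w)\<^sup>2) - (g w - \<kappa> / 2 * (w - w)\<^sup>2) = (g' \<xi> - \<kappa> * (\<xi> - w)) * (z - w)"
        using mvt_within[OF d zw(2,1)] by metis
      have "0 \<le> (g' \<xi> - \<kappa> * (\<xi> - w)) * (z - w)"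
        using inc[OF zw(1) \<xi>(1)] \<xi>(2) zw(3) True by (intro mult_nonneg_nonneg) auto
      moreover have "\<kappa> / 2 * (z - w)\<^sup>2 = \<kappa> * (z - w)\<^sup>2 / 2" by simp
      ultimately have "\<kappa> * (z - w)\<^sup>2 / 2 \<le> g z - g w" using \<xi>(3) by simp
      then show ?thesis by linarith
    next
      case False
      then have z: "g' z \<le> 0" using sd by simp
      obtain \<xi> where \<xi>: "\<xi> \<in> {a..b}" "\<xi> \<le> max z w"
        "(g z - \<kappa> / 2 * (z - z)\<^sup>2) - (g w - \<kappa> / 2 * (w - z)\<^sup>2) = (g' \<xi> - \<kappa> * (\<xi> - z)) * (z - w)"
        using mvt_within[OF d zw(2,1)] by metis
      have "(g' \<xi> - \<kappa> * (\<xi> - z)) * (z - w) \<le> 0"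
        using inc[OF \<xi>(1) zw(2)] \<xi>(2) zw(3) z by (intro mult_nonpos_nonneg) (auto simp: algebra_simps)
      then have "\<kappa> * (w - z)\<^sup>2 / 2 \<le> g w - g z" using \<xi>(3) by simp
      then show ?thesis unfolding power2_commute[of z w] abs_minus_commute[of "g z"] by linarith
    qed
  qed
  show ?thesis
  proof (cases "x \<le> y")
    case True
    then show ?thesis using main[OF xy True] side by (auto simp: power2_commute[of x y] abs_minus_commute)
  next
    case False
    then show ?thesis using main[OF xy(2,1)] side by auto
  qed
qed

lemma ex_largest_nat:
  fixes P :: "nat \<Rightarrow> bool"
  assumes "P 0" "\<exists>N. \<forall>n\<ge>N. \<not> P n"
  obtains n where "P n" "\<not> P (Suc n)"
  using assms by (metis le_refl nat_induct)

text \<open>The sign \<open>\<epsilon>\<close> lets convex and concave arcs be treated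
  together.\<close>

lemma constant_sign:
  fixes g :: "real \<Rightarrow> real"
  assumes "a < b" "continuous_on {a..b} g" "\<And>x. x \<in> {a..b} \<Longrightarrow> g x \<noteq> 0"
  obtains \<epsilon> m where "\<bar>\<epsilon>\<bar> = 1" "0 < m" "\<And>x. x \<in> {a..b} \<Longrightarrow> m \<le> \<epsilon> * g x"
proof -
  have "connected (g ` {a..b})" using assms(2) by (intro connected_continuous_image) auto
  then have "is_interval (g ` {a..b})" by (simp add: is_interval_connected_1)
  moreover have "0 \<notin> g ` {a..b}" using assms(3) by force
  ultimately have "(\<forall>x\<in>{a..b}. 0 < g x) \<or> (\<forall>x\<in>{a..b}. g x < 0)"
    unfolding is_interval_1 by (metis assms(3) imageI less_eq_real_def linorder_neqE_linordered_idom)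
  then obtain \<epsilon> :: real where \<epsilon>: "\<bar>\<epsilon>\<bar> = 1" "\<And>x. x \<in> {a..b} \<Longrightarrow> 0 < \<epsilon> * g x"
    by (metis abs_minus_cancel abs_one mult_1 mult_minus1 neg_0_less_iff_less)
  have "continuous_on {a..b} (\<lambda>x. \<epsilon> * g x)" using assms(2) by (intro continuous_intros)
  then obtain x0 where "x0 \<in> {a..b}" "\<And>x. x \<in> {a..b} \<Longrightarrow> \<epsilon> * g x0 \<le> \<epsilon> * g x"
    using continuous_attains_inf[of "{a..b}" "\<lambda>x. \<epsilon> * g x"] assms(1) by auto
  then show ?thesis using \<epsilon> that by blast
qed

lemma continuous_on_interval_bounded:
  fixes g :: "real \<Rightarrow> real"
  assumes "continuous_on {a..b} g"
  obtains M where "0 \<le> M" "\<And>x. x \<in> {a..b} \<Longrightarrow> \<bar>g x\<bar> \<le> M"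
proof -
  have "bounded (g ` {a..b})"
    using assms by (intro compact_imp_bounded compact_continuous_image) auto
  then obtain M where "\<forall>x\<in>{a..b}. \<bar>g x\<bar> \<le> M" unfolding bounded_iff by auto
  then show ?thesis using that[of "max 0 M"] by fastforce
qed

subsection \<open>Rational points and lines near the arc\<close>

text \<open>\<open>S\<close> may exceed the maximum of |f''|. The margin
  \<open>16 + 8 * S1 < S\<close> later forces integer cross products to vanish, and a large
  \<open>S\<close> also keeps the lengths of comparison below 1 / \<open>S\<close>.\<close>

locale curved_arc =
  fixes i j a b :: real and f f' f'' :: "real \<Rightarrow> real" and S1 S m \<epsilon> :: real
  assumes ij: "0 < j" "j \<le> i" "i + j = 1"
    and f': "\<And>x. x \<in> {a..b} \<Longrightarrow> (f has_real_derivative f' x) (at x within {a..b})"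
    and f'': "\<And>x. x \<in> {a..b} \<Longrightarrow> (f' has_real_derivative f'' x) (at x within {a..b})"
    and S1: "\<And>x. x \<in> {a..b} \<Longrightarrow> \<bar>f' x\<bar> \<le> S1" "0 \<le> S1"
    and S: "\<And>x. x \<in> {a..b} \<Longrightarrow> \<bar>f'' x\<bar> \<le> S" "16 + 8 * S1 < S"
    and m: "0 < m" "\<And>x. x \<in> {a..b} \<Longrightarrow> m \<le> \<epsilon> * f'' x"
    and \<epsilon>: "\<bar>\<epsilon>\<bar> = 1"
begin

lemma i_less_1: "i < 1" and S_pos: "0 < S"
  using ij S S1 by auto

text \<open>With |A| at most 2 Q^i, |B| at most 2 Q^j and j \<le> i, the slope A + B f'(x) is at
  most \<open>S0\<close> Q^i.\<close>

definition S0 :: real where "S0 = 2 * (1 + S1)"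

definition near :: "real \<Rightarrow> int \<Rightarrow> int \<Rightarrow> int \<Rightarrow> real \<Rightarrow> bool" where
  "near c q p r x \<longleftrightarrow> 1 \<le> q \<and> \<bar>q * x - p\<bar> < c * q powr - i \<and> \<bar>q * f x - r\<bar> < c * q powr - j"

text \<open>The order is by denominator, not by distance.\<close>

definition nearest :: "real \<Rightarrow> int \<Rightarrow> int \<Rightarrow> int \<Rightarrow> real \<Rightarrow> bool" where
  "nearest c q p r x \<longleftrightarrow> near c q p r x \<and> (\<forall>q' p' r'. near c q' p' r' x \<longrightarrow> q \<le> q')"

text \<open>The choice depends on the triple only, so two points of the arc with the same rational
  point receive the same line. The parallelism argument ends with this fact.\<close>

definition line_through :: "int \<times> int \<times> int \<Rightarrow> int \<times> int \<times> int" where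
  "line_through = (\<lambda>(q, p, r). SOME (A :: int, B :: int, C :: int). (A \<noteq> 0 \<or> B \<noteq> 0) \<and>
    \<bar>real_of_int A\<bar> \<le> q powr i \<and> \<bar>real_of_int B\<bar> \<le> q powr j \<and> A * p + B * r + C * q = 0)"

lemma line_through:
  assumes "1 \<le> q" "line_through (q, p, r) = (A, B, C)"
  shows "A \<noteq> 0 \<or> B \<noteq> 0" "\<bar>real_of_int A\<bar> \<le> q powr i" "\<bar>real_of_int B\<bar> \<le> q powr j"
    "A * p + B * r + C * q = 0"
proof -
  let ?P = "\<lambda>(A :: int, B :: int, C :: int). (A \<noteq> 0 \<or> B \<noteq> 0) \<and>
    \<bar>real_of_int A\<bar> \<le> q powr i \<and> \<bar>real_of_int B\<bar> \<le> q powr j \<and> A * p + B * r + C * q = 0"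
  obtain A' B' C' where "?P (A', B', C')"
    using line_through_rational_point[OF assms(1) _ _ ij(3), of p r] ij by auto
  then have "\<exists>L. ?P L" by (intro exI[of _ "(A', B', C')"]) simp
  then have "?P (line_through (q, p, r))"
    unfolding line_through_def prod.case by (rule someI_ex)
  then show "A \<noteq> 0 \<or> B \<noteq> 0" "\<bar>real_of_int A\<bar> \<le> q powr i" "\<bar>real_of_int B\<bar> \<le> q powr j"
    "A * p + B * r + C * q = 0"
    unfolding assms(2) by simp_all
qed

lemma line_through_value_le:
  assumes n: "near c q p r x" and l: "line_through (q, p, r) = (A, B, C)"
  shows "\<bar>A * x + B * f x + C\<bar> \<le> 2 * c / q"
proof -
  have q: "1 \<le> q" using n by (simp add: near_def)
  note L = line_through[OF q l]
  have "real_of_int (A * p + B * r + C * q) = 0" using L(4) by simp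
  then have "q * (A * x + B * f x + C) = A * (q * x - p) + B * (q * f x - r)"
    by (simp add: algebra_simps)
  also have "\<bar>\<dots>\<bar> \<le> \<bar>real_of_int A\<bar> * \<bar>q * x - p\<bar> + \<bar>real_of_int B\<bar> * \<bar>q * f x - r\<bar>"
    by (metis abs_mult abs_triangle_ineq)
  also have "\<dots> \<le> q powr i * (c * q powr - i) + q powr j * (c * q powr - j)"
    using n L by (intro add_mono mult_mono) (auto simp: near_def)
  also have "\<dots> = 2 * c" using q by (simp add: powr_minus field_simps)
  finally have "q * \<bar>A * x + B * f x + C\<bar> \<le> 2 * c" using q by (simp add: abs_mult)
  then show ?thesis using q by (simp add: field_simps)
qed

text \<open>If q1 < q2, the first triple would approximate x2 as well: its errors are those of the
  second times q1/q2, while the tolerance c q^(-e) is larger for q1. This contradicts the minimality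
  of q2 at x2.\<close>

lemma nearest_proportional:
  assumes n: "nearest c q1 p1 r1 x1" "nearest c q2 p2 r2 x2"
    and e: "p1 * q2 = p2 * q1" "r1 * q2 = r2 * q1"
  shows "q2 \<le> q1"
proof (rule ccontr)
  assume lt: "\<not> q2 \<le> q1"
  have q: "1 \<le> q1" "1 \<le> q2" using n by (auto simp: nearest_def near_def)
  have step: "\<bar>q1 * z - s1\<bar> < c * q1 powr - e"
    if "s1 * q2 = s2 * q1" "\<bar>q2 * z - s2\<bar> < c * q2 powr - e" "0 < e" for s1 s2 :: int and z e :: real
  proof -
    have "0 < c * q2 powr - e" using that(2) abs_ge_zero le_less_trans by blast
    then have c: "0 < c" using powr_ge_zero[of q2 "- e"] by (auto simp: zero_less_mult_iff)
    have "real_of_int (s1 * q2) = real_of_int (s2 * q1)" using that by simp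
    then have "q2 * (q1 * z - s1) = q1 * (q2 * z - s2)" by (simp add: algebra_simps)
    then have "\<bar>q2 * (q1 * z - s1)\<bar> = \<bar>q1 * (q2 * z - s2)\<bar>" by (simp only:)
    then have "q2 * \<bar>q1 * z - s1\<bar> = q1 * \<bar>q2 * z - s2\<bar>"
      using q by (simp add: abs_mult)
    also have "\<dots> \<le> q2 * \<bar>q2 * z - s2\<bar>" using lt by (intro mult_right_mono) auto
    finally have "\<bar>q1 * z - s1\<bar> \<le> \<bar>q2 * z - s2\<bar>" using q by simp
    also have "\<dots> < c * q2 powr - e" by fact
    also have "\<dots> \<le> c * q1 powr - e"
      using c lt q that by (intro mult_left_mono powr_mono2') auto
    finally show ?thesis .
  qed
  have "near c q1 p1 r1 x2"
    using n(2) step[OF e(1)] step[OF e(2)] ij q by (auto simp: near_def nearest_def)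
  then show False using n(2) lt unfolding nearest_def by blast
qed

lemma f_lipschitz:
  assumes "x \<in> {a..b}" "y \<in> {a..b}"
  shows "\<bar>f x - f y\<bar> \<le> S1 * \<bar>x - y\<bar>"
proof -
  obtain t where "t \<in> {a..b}" "f x - f y = f' t * (x - y)"
    using mvt_within[OF f' assms] by metis
  then show ?thesis using S1(1) by (auto simp: abs_mult intro: mult_right_mono)
qed

section \<open>Inhomogeneous solutions\<close>

definition inhom_near :: "real \<Rightarrow> real \<Rightarrow> real \<Rightarrow> nat \<Rightarrow> real set" where
  "inhom_near \<gamma> \<delta> c2 u = {x \<in> {a..b}. \<exists>(q :: int) (p :: int) (r :: int). (2 :: int) ^ u \<le> q \<and> q < (2 :: int) * 2 ^ u \<and>
     \<bar>q * x - p - \<gamma>\<bar> < c2 * q powr - i \<and> \<bar>q * f x - r - \<delta>\<bar> < c2 * q powr - j}"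

text \<open>The difference of two inhomogeneous solutions near each other is a homogeneous solution.\<close>

lemma inhom_near_close:
  assumes x: "x1 \<in> inhom_near \<gamma> \<delta> c2 u" "x2 \<in> inhom_near \<gamma> \<delta> c2 u"
    and hom: "\<And>q p r. \<not> near c q p r x1" "\<And>q p r. \<not> near c q p r x2"
    and c: "0 < c1" "0 < c2" "2 * c2 + 2 * c1 * (1 + S1) < c" "c \<le> 1"
    and d: "\<bar>x1 - x2\<bar> \<le> c1 * (2 powr - (1 + i)) ^ u"
  shows "\<bar>x1 - x2\<bar> \<le> 2 * c2 * (2 powr - (1 + i)) ^ u"
proof -
  define Q where "Q = (2 ^ u :: real)"
  have Q: "1 \<le> Q" by (simp add: Q_def)
  have \<theta>: "(2 powr - (1 + i)) ^ u = Q powr - i / Q"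
  proof -
    have "(2 powr - (1 + i)) ^ u = (2 powr - (1 + i)) powr real u" by (simp add: powr_realpow)
    also have "\<dots> = (2 powr real u) powr - (1 + i)" by (simp add: powr_powr mult.commute)
    also have "2 powr real u = Q" by (simp add: powr_realpow Q_def)
    also have "- (1 + i) = - 1 + - i" by simp
    also have "Q powr (- 1 + - i) = Q powr - 1 * Q powr - i" by (rule powr_add)
    finally show ?thesis using Q by (simp add: powr_minus divide_inverse mult.commute)
  qed
  \<comment> \<open>\<open>z1\<close> is the point with the smaller denominator; the other order
    follows by exchanging the points.\<close>
  have main: "\<bar>z1 - z2\<bar> \<le> 2 * c2 * (Q powr - i / Q)"
    if z: "z1 \<in> {a..b}" "z2 \<in> {a..b}" and h: "\<And>q p r. \<not> near c q p r z1"
      and dz: "\<bar>z1 - z2\<bar> \<le> c1 * (Q powr - i / Q)"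
      and q: "2 ^ u \<le> q1" "q1 < 2 * 2 ^ u" "2 ^ u \<le> q2" "q2 < 2 * 2 ^ u" "q1 \<le> q2"
      and n1: "\<bar>q1 * z1 - p1 - \<gamma>\<bar> < c2 * q1 powr - i" "\<bar>q1 * f z1 - r1 - \<delta>\<bar> < c2 * q1 powr - j"
      and n2: "\<bar>q2 * z2 - p2 - \<gamma>\<bar> < c2 * q2 powr - i" "\<bar>q2 * f z2 - r2 - \<delta>\<bar> < c2 * q2 powr - j"
    for z1 z2 :: real and q1 q2 p1 p2 r1 r2 :: int
  proof -
    have "real_of_int (2 ^ u) \<le> q1" "real_of_int (2 ^ u) \<le> q2" "real_of_int q2 < real_of_int (2 * 2 ^ u)"
      using q by (simp_all only: of_int_le_iff of_int_less_iff)
    then have qQ: "Q \<le> q1" "Q \<le> q2" "q2 < 2 * Q" by (simp_all add: Q_def)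
    have pm: "c2 * q powr - e \<le> c2 * Q powr - e" if "Q \<le> q" "0 < e" for q e
      using that Q c by (intro mult_left_mono powr_mono2') auto
    have shift: "\<bar>q2 * (z1 - z2)\<bar> \<le> 2 * c1 * Q powr - i"
    proof -
      have "\<bar>q2 * (z1 - z2)\<bar> \<le> 2 * Q * (c1 * (Q powr - i / Q))"
        unfolding abs_mult using qQ Q dz by (intro mult_mono) auto
      then show ?thesis using Q by simp
    qed
    \<comment> \<open>Here j \<le> i is used: moving the point changes q2 f by O(Q^(-i)), which is
      within the tolerance Q^(-j).\<close>
    have shift': "\<bar>q2 * (f z1 - f z2)\<bar> \<le> 2 * c1 * S1 * Q powr - j"
    proof -
      have "\<bar>q2 * (f z1 - f z2)\<bar> \<le> 2 * Q * (S1 * (c1 * (Q powr - i / Q)))"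
        unfolding abs_mult using qQ Q S1(2)
        by (intro mult_mono order_trans[OF f_lipschitz[OF z] mult_left_mono[OF dz]]) auto
      also have "\<dots> = 2 * c1 * S1 * Q powr - i" using Q by simp
      also have "\<dots> \<le> 2 * c1 * S1 * Q powr - j"
        using Q ij c S1 by (intro mult_left_mono powr_mono) auto
      finally show ?thesis .
    qed
    have m1: "\<bar>q1 * z1 - p1 - \<gamma>\<bar> < c2 * Q powr - i" "\<bar>q1 * f z1 - r1 - \<delta>\<bar> < c2 * Q powr - j"
      and m2: "\<bar>q2 * z2 - p2 - \<gamma>\<bar> < c2 * Q powr - i" "\<bar>q2 * f z2 - r2 - \<delta>\<bar> < c2 * Q powr - j"
      using n1 n2 pm[of q1 i] pm[of q1 j] pm[of q2 i] pm[of q2 j] qQ ij by auto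
    show ?thesis
    proof (cases "q1 = q2")
      \<comment> \<open>With equal denominators the difference has denominator 0 and is no
        homogeneous solution. But then p1 - p2 is an integer of absolute value less than 1, and the
        first coordinate alone bounds the distance.\<close>
      case True
      have "real_of_int (p1 - p2) = q2 * (z1 - z2) - (q1 * z1 - p1 - \<gamma>) + (q2 * z2 - p2 - \<gamma>)"
        using True by (simp add: algebra_simps)
      also have "\<bar>\<dots>\<bar> < 2 * c1 * Q powr - i + 2 * (c2 * Q powr - i)"
        using shift m1(1) m2(1) by linarith
      also have "\<dots> = (2 * c2 + 2 * c1) * Q powr - i" by (simp add: algebra_simps)
      also have "\<dots> \<le> 1 * 1"
      proof (intro mult_mono)
        have "0 \<le> c1 * S1" using c S1 by simp
        then show "2 * c2 + 2 * c1 \<le> 1" using c by (simp add: algebra_simps)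
        show "Q powr - i \<le> 1" using Q ij powr_mono2'[of "- i" 1 Q] by simp
      qed auto
      finally have "p1 = p2" by simp
      then have "q2 * (z1 - z2) = (q1 * z1 - p1 - \<gamma>) - (q2 * z2 - p2 - \<gamma>)"
        using True by (simp add: algebra_simps)
      then have "\<bar>q2 * (z1 - z2)\<bar> \<le> 2 * (c2 * Q powr - i)" using m1 m2 by linarith
      moreover have "Q * \<bar>z1 - z2\<bar> \<le> \<bar>q2 * (z1 - z2)\<bar>"
        unfolding abs_mult using qQ Q by (intro mult_right_mono) auto
      ultimately have "Q * \<bar>z1 - z2\<bar> \<le> 2 * (c2 * Q powr - i)" by linarith
      then show ?thesis using Q by (simp add: field_simps)
    next
      case False
      define q where "q = q2 - q1"
      have q1: "1 \<le> q" using q False by (simp add: q_def)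
      have qle: "real_of_int q \<le> Q" using qQ by (simp add: q_def)
      have "0 \<le> c1 * (1 + S1)" using c S1 by simp
      then have c0: "0 \<le> c" using c by simp
      have up: "c * Q powr - e \<le> c * q powr - e" if "0 < e" for e
        using q1 qle that c0 by (intro mult_left_mono powr_mono2') auto
      have "q * z1 - (p2 - p1) = q2 * (z1 - z2) + (q2 * z2 - p2 - \<gamma>) - (q1 * z1 - p1 - \<gamma>)"
        by (simp add: q_def algebra_simps)
      then have "\<bar>q * z1 - (p2 - p1)\<bar> < 2 * c1 * Q powr - i + 2 * (c2 * Q powr - i)"
        using shift m1(1) m2(1) by linarith
      also have "\<dots> = (2 * c2 + 2 * c1) * Q powr - i" by (simp add: algebra_simps)
      also have "\<dots> \<le> c * Q powr - i"
      proof (intro mult_right_mono)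
        have "0 \<le> c1 * S1" using c S1 by simp
        then show "2 * c2 + 2 * c1 \<le> c" using c by (simp add: algebra_simps)
      qed auto
      also have "\<dots> \<le> c * q powr - i" using up ij by simp
      finally have a: "\<bar>q * z1 - (p2 - p1)\<bar> < c * q powr - i" .
      have "q * f z1 - (r2 - r1) = q2 * (f z1 - f z2) + (q2 * f z2 - r2 - \<delta>) - (q1 * f z1 - r1 - \<delta>)"
        by (simp add: q_def algebra_simps)
      then have "\<bar>q * f z1 - (r2 - r1)\<bar> < 2 * c1 * S1 * Q powr - j + 2 * (c2 * Q powr - j)"
        using shift' m1(2) m2(2) by linarith
      also have "\<dots> = (2 * c2 + 2 * c1 * S1) * Q powr - j" by (simp add: algebra_simps)
      also have "\<dots> \<le> c * Q powr - j"
        using c by (intro mult_right_mono) (auto simp: algebra_simps)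
      also have "\<dots> \<le> c * q powr - j" using up ij by simp
      finally have "\<bar>q * f z1 - (r2 - r1)\<bar> < c * q powr - j" .
      with a have "near c q (p2 - p1) (r2 - r1) z1" using q1 by (simp add: near_def)
      then show ?thesis using h by blast
    qed
  qed
  obtain q1 p1 r1 :: int where 1: "2 ^ u \<le> q1" "q1 < 2 * 2 ^ u" "\<bar>q1 * x1 - p1 - \<gamma>\<bar> < c2 * q1 powr - i"
    "\<bar>q1 * f x1 - r1 - \<delta>\<bar> < c2 * q1 powr - j"
    using x(1) unfolding inhom_near_def by blast
  obtain q2 p2 r2 :: int where 2: "2 ^ u \<le> q2" "q2 < 2 * 2 ^ u" "\<bar>q2 * x2 - p2 - \<gamma>\<bar> < c2 * q2 powr - i"
    "\<bar>q2 * f x2 - r2 - \<delta>\<bar> < c2 * q2 powr - j"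
    using x(2) unfolding inhom_near_def by blast
  have x': "x1 \<in> {a..b}" "x2 \<in> {a..b}" using x by (auto simp: inhom_near_def)
  show ?thesis
  proof (cases "q1 \<le> q2")
    case True
    show ?thesis unfolding \<theta>
      by (rule main[OF x' hom(1) d[unfolded \<theta>] 1(1,2) 2(1,2) True 1(3,4) 2(3,4)])
  next
    case False
    then have le: "q2 \<le> q1" by simp
    show ?thesis unfolding \<theta> abs_minus_commute[of x1]
      by (rule main[OF x'(2,1) hom(2) d[unfolded \<theta> abs_minus_commute[of x1]] 2(1,2) 1(1,2) le 2(3,4) 1(3,4)])
  qed
qed

lemma not_Bad_inhom_near:
  assumes x: "x \<in> {a..b}" "x \<notin> Bad_curve {a..b} f (\<gamma>, \<delta>) i j" and c2: "0 < c2" "c2 \<le> 1"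
  obtains u where "x \<in> inhom_near \<gamma> \<delta> c2 u"
proof -
  \<comment> \<open>This makes c'^j = c2/2, and c'^i = (c2/2)^(i/j) is no larger because i/j \<ge> 1
    and c2/2 \<le> 1; so one constant serves both coordinates.\<close>
  define c' where "c' = (c2 / 2) powr (1 / j)"
  have c': "0 < c'" "c' powr j < c2" using c2 ij by (auto simp: c'_def powr_powr)
  have ci: "c' powr i < c2"
  proof -
    have "c' powr i = (c2 / 2) powr (i / j)" by (simp add: c'_def powr_powr)
    also have "\<dots> \<le> (c2 / 2) powr 1" using c2 ij by (intro powr_mono') auto
    finally show ?thesis using c2 by simp
  qed
  obtain q :: nat where q: "1 \<le> q" "max (dist_int (real q * x - \<gamma>) powr (1 / i))
       (dist_int (real q * f x - \<delta>) powr (1 / j)) \<le> c' / real q"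
  proof -
    have "\<not> (\<forall>q::nat. q \<ge> 1 \<longrightarrow> max (dist_int (real q * x - \<gamma>) powr (1 / i))
       (dist_int (real q * f x - \<delta>) powr (1 / j)) > c' / real q)"
      using x c'(1) unfolding Bad_curve_def Bad_def by auto
    then show ?thesis using that by (auto simp only: not_all not_imp not_less)
  qed
  have dist: "\<bar>t - round t\<bar> < c2 * real q powr - e"
    if "dist_int t powr (1 / e) \<le> c' / real q" "0 < e" "c' powr e < c2" for t e
  proof -
    have "dist_int t = (dist_int t powr (1 / e)) powr e"
      using that by (simp add: powr_powr dist_int_def)
    also have "\<dots> \<le> (c' / q) powr e" using that by (intro powr_mono2) auto
    also have "\<dots> = c' powr e * real q powr - e" unfolding powr_divide powr_minus by (simp add: divide_inverse)
    also have "\<dots> < c2 * real q powr - e" using that q by (intro mult_strict_right_mono) auto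
    finally show ?thesis by (simp add: dist_int_def)
  qed
  obtain u where u: "2 ^ u \<le> q" "q < 2 ^ (u + 1)" using ex_power_ivl1[of 2 q] q by auto
  have "2 ^ u \<le> int q" "int q < 2 * 2 ^ u"
    using u by (metis of_nat_le_iff of_nat_numeral of_nat_power)
      (metis u(2) of_nat_less_iff of_nat_numeral of_nat_power power_Suc Suc_eq_plus1 of_nat_mult)
  moreover have "\<bar>real q * x - round (real q * x - \<gamma>) - \<gamma>\<bar> < c2 * real q powr - i"
    using dist[of "real q * x - \<gamma>" i] q ci ij by (simp add: algebra_simps)
  moreover have "\<bar>real q * f x - round (real q * f x - \<delta>) - \<delta>\<bar> < c2 * real q powr - j"
    using dist[of "real q * f x - \<delta>" j] q c' ij by (simp add: algebra_simps)
  ultimately have "x \<in> {a..b} \<and> 2 ^ u \<le> int q \<and> int q < 2 * 2 ^ u \<and>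
      \<bar>of_int (int q) * x - of_int (round (real q * x - \<gamma>)) - \<gamma>\<bar> < c2 * of_int (int q) powr - i \<and>
      \<bar>of_int (int q) * f x - of_int (round (real q * f x - \<delta>)) - \<delta>\<bar> < c2 * of_int (int q) powr - j"
    using x(1) by simp
  then have "x \<in> inhom_near \<gamma> \<delta> c2 u"
    unfolding inhom_near_def mem_Collect_eq by blast
  then show ?thesis by (rule that)
qed

end

section \<open>Dyadic classes of homogeneous solutions\<close>

locale clumping = curved_arc +
  fixes X0 c :: real
  assumes X0: "1 \<le> X0" and c: "0 < c" "c * (8192 * S * S0\<^sup>2 * X0\<^sup>2) \<le> 1"
begin

text \<open>The indices \<open>u\<close>, \<open>k\<close>, \<open>v\<close> give the dyadic sizes of the denominator of a rational point and of the
  slope and the coefficient of \<open>f\<close> in the line chosen through it; points of one class are compared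
  over the length \<open>reach u k v\<close>. A steep line is small only over a length shorter by the factor \<open>gain\<close>.
  The exponent \<open>j / 2\<close> is smaller than \<open>i\<close> and \<open>j\<close>, which leaves room in the parallelism argument.\<close>

definition slope_bound :: "nat \<Rightarrow> nat \<Rightarrow> real" where "slope_bound u k = S0 * (2 ^ u) powr i / 2 ^ k"
definition coeff_bound :: "nat \<Rightarrow> nat \<Rightarrow> real" where "coeff_bound u v = 2 * (2 ^ u) powr j / 2 ^ v"
definition gain :: "nat \<Rightarrow> nat \<Rightarrow> real" where "gain k v = X0 * (2 ^ (k + v)) powr (j / 2)"
definition reach :: "nat \<Rightarrow> nat \<Rightarrow> nat \<Rightarrow> real" where "reach u k v = gain k v * c / (2 ^ u * slope_bound u k)"
definition admissible :: "nat \<Rightarrow> nat \<Rightarrow> nat \<Rightarrow> bool" where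
  "admissible u k v \<longleftrightarrow> 1 \<le> coeff_bound u v \<and> S * gain k v * c * coeff_bound u v \<le> 2 ^ u * (slope_bound u k)\<^sup>2"

lemma gain_ge_1: "1 \<le> gain k v"
proof -
  have "1 * 1 \<le> X0 * (2 ^ (k + v)) powr (j / 2)"
    using X0 ij by (intro mult_mono ge_one_powr_ge_zero) auto
  then show ?thesis by (simp add: gain_def)
qed

lemma gain_pos: "0 < gain k v"
  using gain_ge_1[of k v] by simp

lemma slope_bound_pos: "0 < slope_bound u k" and coeff_bound_pos: "0 < coeff_bound u v"
  using S1 by (auto simp: slope_bound_def coeff_bound_def S0_def)

lemma reach_pos: "0 < reach u k v"
  using slope_bound_pos gain_pos c by (simp add: reach_def)

lemma S_ge: "16 < S" "2 \<le> S0" "S1 \<le> S0"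
  using S S1 by (auto simp: S0_def)

text \<open>The first bound serves \<open>admissible_bounds\<close> and the admissibility of k = 0.
  The second is 12 * X0 * (256 * S0^2 * X0) * c < 1, needed when k + v is bounded. The third
  excludes B = 0 when admissibility fails at k + 1.\<close>

lemma c_small: "2 * X0 * S0 * S * c \<le> 1" "3072 * S0\<^sup>2 * X0\<^sup>2 * c < 1" "32 * S * S0 * X0 * c \<le> 1"
proof -
  have 1: "S0 * X0 \<le> S0\<^sup>2 * X0\<^sup>2"
    using X0 S_ge self_le_power[of S0 2] self_le_power[of X0 2] by (intro mult_mono) auto
  have 2: "0 < S0\<^sup>2 * X0\<^sup>2" using S_ge X0 by (simp add: power2_eq_square)
  have "32 * (S * c) * (S0 * X0) \<le> 32 * (S * c) * (S0\<^sup>2 * X0\<^sup>2)"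
    using c S_ge by (intro mult_left_mono 1) auto
  also have "\<dots> \<le> 8192 * (S * c) * (S0\<^sup>2 * X0\<^sup>2)"
    using c S_ge 2 by (intro mult_right_mono) auto
  also have "\<dots> \<le> 1" using c by (simp add: mult_ac)
  finally show a: "32 * S * S0 * X0 * c \<le> 1" by (simp add: mult_ac)
  have "0 \<le> 30 * S * S0 * X0 * c" using S_ge X0 c by simp
  then show "2 * X0 * S0 * S * c \<le> 1" using a by (simp add: mult_ac)
  have "8192 * (S0\<^sup>2 * X0\<^sup>2) * c * 16 \<le> 8192 * (S0\<^sup>2 * X0\<^sup>2) * c * S"
    using c 2 S_ge by (intro mult_left_mono) (auto intro!: mult_nonneg_nonneg)
  also have "\<dots> \<le> 1" using c by (simp add: mult_ac)
  finally show "3072 * S0\<^sup>2 * X0\<^sup>2 * c < 1" using 2 c by (simp add: mult_ac)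
qed

text \<open>The determinant of two lines of a class is O(\<open>slope_bound\<close> *
  \<open>coeff_bound\<close>), so this is what pushes the denominator of their intersection below
  2^u by the factor 2^(k+v).\<close>

lemma slope_bound_coeff_bound: "2 ^ (k + v) * (slope_bound u k * coeff_bound u v) = 2 * S0 * 2 ^ u"
proof -
  have "(2 ^ u :: real) powr i * (2 ^ u) powr j = 2 ^ u" using ij by (simp flip: powr_add)
  then show ?thesis by (simp add: slope_bound_def coeff_bound_def power_add field_simps)
qed

lemma reach_slope_bound: "reach u k v * slope_bound u k = gain k v * c / 2 ^ u"
  using slope_bound_pos[of u k] by (simp add: reach_def)

text \<open>When \<open>admissible\<close> holds, the second-order term of a line over an interval of length \<open>reach u k v\<close> is
  dominated by the bound \<open>slope_bound u k\<close> on its slope.\<close>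

lemma admissible_reach:
  assumes "admissible u k v"
  shows "coeff_bound u v * S * reach u k v \<le> slope_bound u k"
proof -
  have "coeff_bound u v * S * reach u k v = S * gain k v * c * coeff_bound u v / (2 ^ u * slope_bound u k)"
    by (simp add: reach_def)
  also have "\<dots> \<le> 2 ^ u * (slope_bound u k)\<^sup>2 / (2 ^ u * slope_bound u k)"
    using assms slope_bound_pos[of u k] by (intro divide_right_mono) (auto simp: admissible_def)
  finally show ?thesis by (simp add: power2_eq_square)
qed

text \<open>The number \<open>gain k v * c / 2 ^ u\<close> is the size of a line of the class over
  the length \<open>reach u k v\<close>, up to a constant. The first two bounds make integer cross
  products vanish, the third keeps \<open>reach\<close> short. If the slope bound is at least 1 it
  limits 2^k, just as \<open>1 \<le> coeff_bound u v\<close> limits 2^v; otherwise admissibility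
  gives the first bound directly.\<close>

lemma admissible_bounds:
  assumes "admissible u k v"
  shows "coeff_bound u v * (gain k v * c / 2 ^ u) \<le> 1 / S" "slope_bound u k * (gain k v * c / 2 ^ u) \<le> 1 / S"
    "reach u k v \<le> 1 / S"
proof -
  define Q where "Q = (2 ^ u :: real)"
  define t where "t = gain k v * c / 2 ^ u"
  have Q: "1 \<le> Q" by (simp add: Q_def)
  have t: "0 < t" using gain_pos[of k v] c by (simp add: t_def)
  have B1: "1 \<le> coeff_bound u v" using assms by (simp add: admissible_def)
  have v: "2 ^ v \<le> 2 * Q powr j" using B1 by (simp add: coeff_bound_def Q_def field_simps)
  have QQ: "Q powr i * Q powr j = Q" using ij Q by (simp flip: powr_add)
  have split: "gain k v = X0 * ((2 ^ k) powr (j / 2) * (2 ^ v) powr (j / 2))"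
    by (simp add: gain_def power_add powr_mult)
  have self: "(2 ^ n) powr (j / 2) \<le> (2 ^ n :: real)" for n
    using ij by (intro powr_le_self) auto
  have fin: "2 * (X0 * S0) * Q * c / Q \<le> 1 / S"
    using c_small(1) S_ge Q by (simp add: field_simps)
  have "slope_bound u k * gain k v = S0 * Q powr i * X0 * ((2 ^ k) powr (j / 2) / 2 ^ k) * (2 ^ v) powr (j / 2)"
    by (simp add: slope_bound_def Q_def split)
  also have "\<dots> \<le> S0 * Q powr i * X0 * 1 * (2 * Q powr j)"
    using self[of k] order_trans[OF self[of v] v] S_ge X0 by (intro mult_mono) auto
  also have "\<dots> = 2 * (X0 * S0) * Q" using QQ by (simp add: mult_ac)
  finally have "slope_bound u k * gain k v * c / Q \<le> 2 * (X0 * S0) * Q * c / Q"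
    using c Q by (intro divide_right_mono mult_right_mono) auto
  then show "slope_bound u k * (gain k v * c / 2 ^ u) \<le> 1 / S"
    using fin by (simp add: Q_def[symmetric] mult_ac)
  show Bt: "coeff_bound u v * (gain k v * c / 2 ^ u) \<le> 1 / S"
  proof (cases "1 \<le> slope_bound u k")
    case True
    then have k: "2 ^ k \<le> S0 * Q powr i" by (simp add: slope_bound_def Q_def field_simps)
    have "coeff_bound u v * gain k v = 2 * Q powr j * X0 * (2 ^ k) powr (j / 2) * ((2 ^ v) powr (j / 2) / 2 ^ v)"
      by (simp add: coeff_bound_def Q_def split)
    also have "\<dots> \<le> 2 * Q powr j * X0 * (S0 * Q powr i) * 1"
      using order_trans[OF self[of k] k] self[of v] X0 S_ge by (intro mult_mono) auto
    also have "\<dots> = 2 * (X0 * S0) * Q" using QQ by (simp add: mult_ac)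
    finally have "coeff_bound u v * gain k v * c / Q \<le> 2 * (X0 * S0) * Q * c / Q"
      using c Q by (intro divide_right_mono mult_right_mono) auto
    then show ?thesis using fin by (simp add: Q_def[symmetric] mult_ac)
  next
    case False
    then have "(slope_bound u k)\<^sup>2 \<le> 1" using slope_bound_pos[of u k] by (simp add: power_le_one)
    then have "2 ^ u * (slope_bound u k)\<^sup>2 \<le> 2 ^ u * 1" by (intro mult_left_mono) auto
    then have "S * gain k v * c * coeff_bound u v \<le> 2 ^ u" using assms unfolding admissible_def by linarith
    then show ?thesis using S_pos by (simp add: field_simps)
  qed
  show "reach u k v \<le> 1 / S"
  proof (cases "1 \<le> slope_bound u k")
    case True
    have "reach u k v = t / slope_bound u k" by (simp add: reach_def t_def)
    also have "\<dots> \<le> t" using True t by (simp add: field_simps)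
    also have "\<dots> \<le> coeff_bound u v * t" using B1 t by simp
    finally show ?thesis using Bt by (simp add: t_def)
  next
    case False
    have "S * reach u k v \<le> coeff_bound u v * (S * reach u k v)" using B1 reach_pos[of u k v] S_pos by simp
    also have "\<dots> \<le> 1" using admissible_reach[OF assms] False by (simp add: mult_ac)
    finally show ?thesis using S_pos by (simp add: field_simps)
  qed
qed

text \<open>Only upper bounds on slope and coefficient are recorded; they suffice for parallelism.
  The lower bounds are in \<open>steep\<close>.\<close>

definition in_class ::
    "nat \<Rightarrow> nat \<Rightarrow> nat \<Rightarrow> real \<Rightarrow> int \<Rightarrow> int \<Rightarrow> int \<Rightarrow> int \<Rightarrow> int \<Rightarrow> int \<Rightarrow> bool" where
  "in_class u k v x q p r A B C \<longleftrightarrow> x \<in> {a..b} \<and> nearest c q p r x \<and> line_through (q, p, r) = (A, B, C) \<and>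
    2 ^ u \<le> q \<and> q < 2 * 2 ^ u \<and> \<bar>A + B * f' x\<bar> \<le> slope_bound u k \<and> \<bar>real_of_int B\<bar> \<le> coeff_bound u v"

lemma in_classD:
  assumes "in_class u k v x q p r A B C"
  shows "x \<in> {a..b}" "nearest c q p r x" "near c q p r x" "line_through (q, p, r) = (A, B, C)" "1 \<le> q"
    "2 ^ u \<le> real_of_int q" "real_of_int q < 2 * 2 ^ u"
    "\<bar>A + B * f' x\<bar> \<le> slope_bound u k" "\<bar>real_of_int B\<bar> \<le> coeff_bound u v"
    "A \<noteq> 0 \<or> B \<noteq> 0" "\<bar>real_of_int A\<bar> \<le> 2 * (2 ^ u) powr i" "\<bar>real_of_int B\<bar> \<le> 2 * (2 ^ u) powr j"
    "A * p + B * r + C * q = 0" "\<bar>A * x + B * f x + C\<bar> \<le> 2 * c / 2 ^ u"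
proof -
  note * = assms[unfolded in_class_def]
  show "x \<in> {a..b}" "nearest c q p r x" "line_through (q, p, r) = (A, B, C)"
    "\<bar>A + B * f' x\<bar> \<le> slope_bound u k" "\<bar>real_of_int B\<bar> \<le> coeff_bound u v" using * by auto
  show n: "near c q p r x" using * by (auto simp: nearest_def)
  then show q: "1 \<le> q" by (simp add: near_def)
  have "real_of_int (2 ^ u) \<le> q" "real_of_int q < real_of_int (2 * 2 ^ u)"
    using * by (simp_all only: of_int_le_iff of_int_less_iff)
  then show Q: "2 ^ u \<le> real_of_int q" "real_of_int q < 2 * 2 ^ u" by simp_all
  have l: "line_through (q, p, r) = (A, B, C)" using * by auto
  show "A \<noteq> 0 \<or> B \<noteq> 0" "A * p + B * r + C * q = 0" using line_through[OF q l] by auto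
  have e: "q powr e \<le> 2 * (2 ^ u) powr e" if "0 \<le> e" "e \<le> 1" for e
    using powr_mono2[of e q "2 * 2 ^ u"] double_powr_le[of "2 ^ u" e] that q Q by simp
  show "\<bar>real_of_int A\<bar> \<le> 2 * (2 ^ u) powr i" "\<bar>real_of_int B\<bar> \<le> 2 * (2 ^ u) powr j"
    using line_through[OF q l] e[of i] e[of j] ij by auto
  have "2 * c / q \<le> 2 * c / 2 ^ u" using Q q c by (intro divide_left_mono) (auto intro!: mult_pos_pos)
  then show "\<bar>A * x + B * f x + C\<bar> \<le> 2 * c / 2 ^ u"
    using line_through_value_le[OF n l] by linarith
qed

lemma in_class_spread:
  assumes admissible: "admissible u k v" and cl: "in_class u k v x q p r A B C"
    and y: "y \<in> {a..b}" "\<bar>y - x\<bar> \<le> reach u k v"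
  shows "\<bar>A + B * f' y\<bar> \<le> 2 * slope_bound u k" "\<bar>A * y + B * f y + C\<bar> \<le> 4 * (gain k v * c / 2 ^ u)"
proof -
  note I = in_classD[OF cl]
  have slope: "\<bar>A + B * f' t\<bar> \<le> 2 * slope_bound u k" if t: "t \<in> {a..b}" "\<bar>t - x\<bar> \<le> reach u k v" for t
  proof -
    obtain \<xi> where \<xi>: "\<xi> \<in> {a..b}" "f' t - f' x = f'' \<xi> * (t - x)"
      using mvt_within[OF f'' t(1) I(1)] by metis
    have "\<bar>B * (f' t - f' x)\<bar> = \<bar>real_of_int B\<bar> * (\<bar>f'' \<xi>\<bar> * \<bar>t - x\<bar>)"
      unfolding \<xi>(2) by (simp add: abs_mult)
    also have "\<dots> \<le> coeff_bound u v * (S * reach u k v)"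
      using I(9) S(1)[OF \<xi>(1)] t(2) S_pos by (intro mult_mono) auto
    also have "\<dots> \<le> slope_bound u k" using admissible_reach[OF admissible] by (simp add: mult_ac)
    finally show ?thesis using I(8) by (simp add: algebra_simps abs_le_iff)
  qed
  show "\<bar>A + B * f' y\<bar> \<le> 2 * slope_bound u k" using slope[OF y] .
  have "((\<lambda>z. A * z + B * f z + C) has_real_derivative A + B * f' z) (at z within {a..b})"
    if "z \<in> {a..b}" for z
    using f'[OF that] by (auto intro!: derivative_eq_intros)
  from mvt_within[OF this y(1) I(1)]
  obtain \<xi> where \<xi>: "\<xi> \<in> {a..b}" "min y x \<le> \<xi>" "\<xi> \<le> max y x"
    "(A * y + B * f y + C) - (A * x + B * f x + C) = (A + B * f' \<xi>) * (y - x)" by metis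
  have "\<bar>(A + B * f' \<xi>) * (y - x)\<bar> \<le> 2 * slope_bound u k * reach u k v"
    unfolding abs_mult using \<xi> y slope_bound_pos[of u k] by (intro mult_mono slope) auto
  also have "\<dots> = 2 * (gain k v * c / 2 ^ u)"
    using reach_slope_bound[of u k v] by (simp add: mult_ac)
  finally have "\<bar>A * y + B * f y + C\<bar> \<le> 2 * c / 2 ^ u + 2 * (gain k v * c / 2 ^ u)"
    using I(14) \<xi>(4) by linarith
  moreover have "2 * c / 2 ^ u \<le> 2 * (gain k v * c / 2 ^ u)"
    using gain_ge_1[of k v] c by (simp add: divide_right_mono)
  moreover have "z \<le> e + 2 * t \<Longrightarrow> e \<le> 2 * t \<Longrightarrow> z \<le> 4 * t" for z e t :: real by simp
  ultimately show "\<bar>A * y + B * f y + C\<bar> \<le> 4 * (gain k v * c / 2 ^ u)" by blast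
qed

text \<open>The cross product of two lines is a rational point on both. If they are not parallel, then either
  its denominator is smaller than \<open>2 ^ u\<close> while it is still close to \<open>x1\<close>, contradicting the
  minimality of \<open>q1\<close>, or \<open>k + v\<close> is bounded and each of the two given points lies on both lines.\<close>

lemma in_class_parallel:
  assumes admissible: "admissible u k v" and c1: "in_class u k v x1 q1 p1 r1 A1 B1 C1"
    and c2: "in_class u k v x2 q2 p2 r2 A2 B2 C2" and d: "\<bar>x1 - x2\<bar> \<le> reach u k v"
  shows "A1 * B2 = A2 * B1" "B1 * C2 = B2 * C1" "C1 * A2 = C2 * A1"
proof -
  note I1 = in_classD[OF c1] and I2 = in_classD[OF c2]
  define Q where "Q = (2 ^ u :: real)"
  define t where "t = gain k v * c / Q"
  define W where "W = (2 ^ (k + v) :: real)"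
  define V where "V = W powr (j / 2)"
  define D where "D = slope_bound u k"
  define E where "E = coeff_bound u v"
  define q0 where "q0 = A1 * B2 - A2 * B1"
  define p0 where "p0 = B1 * C2 - B2 * C1"
  define r0 where "r0 = C1 * A2 - C2 * A1"
  have Q: "1 \<le> Q" and W: "1 \<le> W" by (auto simp: Q_def W_def)
  have V: "1 \<le> V" using W ij by (simp add: V_def ge_one_powr_ge_zero)
  have t: "0 < t" using gain_pos c Q by (simp add: t_def)
  have QQ: "Q powr i * Q powr j = Q" using ij Q by (simp flip: powr_add)
  have Qji: "Q powr j \<le> Q powr i" using ij Q by (intro powr_mono) auto
  have XV: "gain k v = X0 * V" by (simp add: gain_def V_def W_def)
  have D: "0 < D" "D \<le> S0 * Q powr i" "0 < E" "E \<le> 2 * Q powr j"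
    using slope_bound_pos coeff_bound_pos S_ge by (auto simp: D_def E_def slope_bound_def coeff_bound_def Q_def field_simps)
  have sl: "\<bar>A1 + B1 * f' x1\<bar> \<le> 2 * D" "\<bar>A2 + B2 * f' x1\<bar> \<le> 2 * D"
    using I1(8) D in_class_spread(1)[OF admissible c2 I1(1) d] by (auto simp: D_def)
  have va1: "\<bar>A1 * x1 + B1 * f x1 + C1\<bar> \<le> 4 * t" "\<bar>A1 * x2 + B1 * f x2 + C1\<bar> \<le> 4 * t"
    using in_class_spread(2)[OF admissible c1 I1(1)] in_class_spread(2)[OF admissible c1 I2(1)] d reach_pos[of u k v]
    by (auto simp: t_def Q_def abs_minus_commute)
  have va2: "\<bar>A2 * x1 + B2 * f x1 + C2\<bar> \<le> 4 * t" "\<bar>A2 * x2 + B2 * f x2 + C2\<bar> \<le> 4 * t"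
    using in_class_spread(2)[OF admissible c2 I1(1)] in_class_spread(2)[OF admissible c2 I2(1)] d reach_pos[of u k v]
    by (auto simp: t_def Q_def)
  have BE: "\<bar>real_of_int B1\<bar> \<le> E" "\<bar>real_of_int B2\<bar> \<le> E" using I1(9) I2(9) by (auto simp: E_def)
  have Bf: "\<bar>B * f' x1\<bar> \<le> E * S1" if "\<bar>real_of_int B\<bar> \<le> E" for B :: int
    unfolding abs_mult using that S1(1)[OF I1(1)] D(3) by (intro mult_mono) auto
  have AE: "\<bar>real_of_int A1\<bar> \<le> 2 * D + E * S1" "\<bar>real_of_int A2\<bar> \<le> 2 * D + E * S1"
    using sl Bf[OF BE(1)] Bf[OF BE(2)] by linarith+
  have hq: "\<bar>real_of_int q0\<bar> \<le> 4 * (D * E)"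
  proof -
    have "real_of_int q0 = (A1 + B1 * f' x1) * B2 - (A2 + B2 * f' x1) * B1"
      by (simp add: q0_def algebra_simps)
    also have "\<bar>\<dots>\<bar> \<le> 2 * D * E + 2 * D * E" using sl BE by (intro abs_det_le)
    finally show ?thesis by simp
  qed
  have hp: "\<bar>q0 * x1 - p0\<bar> \<le> 8 * (E * t)"
  proof -
    have "q0 * x1 - p0 = B2 * (A1 * x1 + B1 * f x1 + C1) - B1 * (A2 * x1 + B2 * f x1 + C2)"
      by (simp add: q0_def p0_def algebra_simps)
    also have "\<bar>\<dots>\<bar> \<le> E * (4 * t) + E * (4 * t)" using va1 va2 BE by (intro abs_det_le)
    finally show ?thesis by simp
  qed
  have hr: "\<bar>q0 * f x1 - r0\<bar> \<le> 8 * ((2 * D + E * S1) * t)"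
  proof -
    have "q0 * f x1 - r0 = A1 * (A2 * x1 + B2 * f x1 + C2) - A2 * (A1 * x1 + B1 * f x1 + C1)"
      by (simp add: q0_def r0_def algebra_simps)
    also have "\<bar>\<dots>\<bar> \<le> (2 * D + E * S1) * (4 * t) + (2 * D + E * S1) * (4 * t)"
      using va1 va2 AE by (intro abs_det_le)
    finally show ?thesis by linarith
  qed
  \<comment> \<open>Here n^e is at most 8 S0 Q^e / V^2, while t carries one factor V. Both errors of
    the intersection, times n^i and n^j, come out at most 256 S0^2 X0 c / V; the threshold on V is
    what makes this less than c.\<close>
  have "q0 = 0"
  proof (cases "256 * S0\<^sup>2 * X0 < V")
    case True
    show ?thesis
    proof (rule ccontr)
      assume q0: "q0 \<noteq> 0"
      define n where "n = real_of_int \<bar>q0\<bar>"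
      have n1: "1 \<le> n" using q0 by (simp add: n_def)
      have WDE: "W * (D * E) = 2 * S0 * Q" using slope_bound_coeff_bound[of k v u] by (simp add: W_def D_def E_def Q_def)
      have nW: "n \<le> 8 * S0 * Q / W"
      proof -
        have "W * n \<le> W * (4 * (D * E))" using hq W by (intro mult_left_mono) (auto simp: n_def)
        also have "\<dots> = 4 * (W * (D * E))" by simp
        also have "\<dots> = 8 * S0 * Q" unfolding WDE by simp
        finally show ?thesis using W by (simp add: field_simps)
      qed
      have VV: "V\<^sup>2 = W powr j" using W by (simp add: V_def power2_eq_square flip: powr_add)
      have ne: "n powr e \<le> 8 * S0 * Q powr e / V\<^sup>2" if "j \<le> e" "e \<le> 1" for e
      proof -
        have "n powr e \<le> (8 * S0 * Q / W) powr e" using nW n1 that ij by (intro powr_mono2) auto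
        also have "\<dots> = (8 * S0) powr e * Q powr e / W powr e"
          by (simp add: powr_divide powr_mult)
        also have "\<dots> \<le> (8 * S0) * Q powr e / W powr j"
          using powr_le_self[of "8 * S0" e] powr_mono[of j e W] that W S_ge ij
          by (intro frac_le mult_right_mono) auto
        finally show ?thesis by (simp add: VV)
      qed
      have Vp: "0 < V" using V by simp
      have tV: "t = X0 * V * c / Q" by (simp add: t_def XV)
      have S02: "S0 \<le> S0\<^sup>2" using S_ge by (simp add: power2_eq_square)
      have lt: "256 * S0\<^sup>2 * X0 * c / V < c" using True Vp c by (simp add: field_simps)
      have "8 * (E * t) * n powr i \<le> 8 * (2 * Q powr j * t) * (8 * S0 * Q powr i / V\<^sup>2)"
        using D t ij i_less_1 ne[of i] by (intro mult_mono) auto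
      also have "\<dots> = 128 * S0 * X0 * c / V * (Q powr i * Q powr j / Q)"
        using Vp by (simp add: tV power2_eq_square mult_ac)
      also have "\<dots> = 128 * S0 * X0 * c / V" using Q by (simp add: QQ)
      also have "\<dots> \<le> 256 * S0\<^sup>2 * X0 * c / V"
        using S02 Vp c X0 S_ge by (intro divide_right_mono mult_right_mono mult_mono) auto
      also note lt
      finally have 1: "\<bar>q0 * x1 - p0\<bar> * n powr i < c"
        using mult_right_mono[OF hp, of "n powr i"] by simp
      have "2 * D + E * S1 \<le> 2 * (S0 * Q powr i) + 2 * Q powr i * S0"
        using D S1 S_ge Qji by (intro add_mono mult_mono) auto
      then have "8 * ((2 * D + E * S1) * t) * n powr j \<le> 8 * ((4 * (S0 * Q powr i)) * t) * (8 * S0 * Q powr j / V\<^sup>2)"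
        using D S1 t ij i_less_1 ne[of j] S_ge by (intro mult_mono) auto
      also have "\<dots> = 256 * S0\<^sup>2 * X0 * c / V * (Q powr i * Q powr j / Q)"
        using Vp by (simp add: tV power2_eq_square mult_ac)
      also have "\<dots> = 256 * S0\<^sup>2 * X0 * c / V" using Q by (simp add: QQ)
      also note lt
      finally have 2: "\<bar>q0 * f x1 - r0\<bar> * n powr j < c"
        using mult_right_mono[OF hr, of "n powr j"] by simp
      \<comment> \<open>A homogeneous solution needs a positive denominator, so the triple is
        multiplied by the sign of \<open>q0\<close>.\<close>
      have sg: "\<bar>n * z - real_of_int (sgn q0 * s)\<bar> = \<bar>q0 * z - s\<bar>" for z :: real and s :: int
      proof -
        have "n * z - real_of_int (sgn q0 * s) = sgn q0 * (q0 * z - s)"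
          by (simp add: n_def algebra_simps abs_sgn sgn_if)
        then show ?thesis using q0 by (simp add: abs_mult sgn_if)
      qed
      have mv: "y < c * n powr - e" if "y * n powr e < c" for y e
        using that n1 by (simp add: powr_minus field_simps)
      have "1 \<le> \<bar>q0\<bar>" using q0 by presburger
      then have "near c \<bar>q0\<bar> (sgn q0 * p0) (sgn q0 * r0) x1"
        using mv[OF 1] mv[OF 2] sg[of x1 p0] sg[of "f x1" r0] unfolding near_def n_def by simp
      then have "q1 \<le> \<bar>q0\<bar>" using I1(2) unfolding nearest_def by blast
      then have "Q \<le> n" using I1(6) unfolding Q_def n_def by linarith
      then have "W * Q \<le> W * n" using W by (intro mult_left_mono) auto
      also have "\<dots> \<le> 8 * S0 * Q" using nW W by (simp add: field_simps)
      finally have "W * Q \<le> 8 * S0 * Q" .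
      then have "W \<le> 8 * S0" using Q by simp
      moreover have "V \<le> W" unfolding V_def using W ij by (intro powr_le_self) auto
      moreover have "8 * S0 \<le> 256 * S0\<^sup>2 * X0"
        using mult_mono[of "8 * S0" "256 * S0\<^sup>2" 1 X0] S02 X0 S_ge by simp
      ultimately show False using True by linarith
    qed
  next
    case False
    have Xc: "12 * (gain k v * c) < 1"
    proof -
      have "X0 * V * c \<le> X0 * (256 * S0\<^sup>2 * X0) * c"
        using False X0 c by (intro mult_right_mono mult_left_mono) auto
      then show ?thesis using c_small(2) by (simp add: XV power2_eq_square mult_ac)
    qed
    \<comment> \<open>This integer has absolute value at most 8 gain c (from the line at
      \<open>x\<close>, times q < 2 Q) plus 4 c (from the approximation errors), hence less than
      1.\<close>
    have inc: "A * p + B * r + C * q = 0"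
      if A: "\<bar>real_of_int A\<bar> \<le> 2 * Q powr i" and B: "\<bar>real_of_int B\<bar> \<le> 2 * Q powr j"
        and val: "\<bar>A * x + B * f x + C\<bar> \<le> 4 * t" and nr: "near c q p r x"
        and q: "Q \<le> real_of_int q" "real_of_int q < 2 * Q" for A B C p r q :: int and x :: real
    proof -
      have pm: "real_of_int q powr - e \<le> Q powr - e" if "0 \<le> e" for e
        using that q Q by (intro powr_mono2') auto
      have qx: "\<bar>q * x - p\<bar> \<le> c * Q powr - i" "\<bar>q * f x - r\<bar> \<le> c * Q powr - j"
        using nr pm[of i] pm[of j] ij c unfolding near_def
        by (auto intro: order_trans[OF less_imp_le mult_left_mono])
      have PQ: "Q powr e * Q powr - e = 1" for e using Q by (simp flip: powr_add)
      have "real_of_int (A * p + B * r + C * q)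
          = q * (A * x + B * f x + C) - (A * (q * x - p) - (- B) * (q * f x - r))"
        by (simp add: algebra_simps)
      also have "\<bar>\<dots>\<bar> \<le> \<bar>q * (A * x + B * f x + C)\<bar> + \<bar>A * (q * x - p) - (- B) * (q * f x - r)\<bar>"
        by (rule abs_triangle_ineq4)
      also have "\<dots> \<le> 2 * Q * (4 * t) +
          (2 * Q powr i * (c * Q powr - i) + 2 * Q powr j * (c * Q powr - j))"
      proof (rule add_mono)
        show "\<bar>q * (A * x + B * f x + C)\<bar> \<le> 2 * Q * (4 * t)"
          unfolding abs_mult using val q Q by (intro mult_mono) auto
        show "\<bar>A * (q * x - p) - (- B) * (q * f x - r)\<bar>
            \<le> 2 * Q powr i * (c * Q powr - i) + 2 * Q powr j * (c * Q powr - j)"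
          using A B qx by (intro abs_det_le) auto
      qed
      also have "\<dots> = 8 * (gain k v * c) + 2 * c * (Q powr i * Q powr - i) + 2 * c * (Q powr j * Q powr - j)"
        using Q by (simp add: t_def)
      also have "\<dots> = 8 * (gain k v * c) + 4 * c" unfolding PQ by simp
      also have "\<dots> \<le> 12 * (gain k v * c)" using gain_ge_1[of k v] c by simp
      also note Xc
      finally show ?thesis by linarith
    qed
    have i12: "A1 * p2 + B1 * r2 + C1 * q2 = 0"
      using inc[OF I1(11,12)[folded Q_def] va1(2) I2(3)] I2(6,7) unfolding Q_def by blast
    have i21: "A2 * p1 + B2 * r1 + C2 * q1 = 0"
      using inc[OF I2(11,12)[folded Q_def] va2(1) I1(3)] I1(6,7) unfolding Q_def by blast
    have pr: "q0 * p = q * p0" "q0 * r = q * r0"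
      if "A1 * p + B1 * r + C1 * q = 0" "A2 * p + B2 * r + C2 * q = 0" for p q r
    proof -
      have "q0 * p - q * p0 = B2 * (A1 * p + B1 * r + C1 * q) - B1 * (A2 * p + B2 * r + C2 * q)"
        by (simp add: q0_def p0_def algebra_simps)
      then show "q0 * p = q * p0" using that by simp
      have "q0 * r - q * r0 = A1 * (A2 * p + B2 * r + C2 * q) - A2 * (A1 * p + B1 * r + C1 * q)"
        by (simp add: q0_def r0_def algebra_simps)
      then show "q0 * r = q * r0" using that by simp
    qed
    note P1 = pr[OF I1(13) i21] and P2 = pr[OF i12 I2(13)]
    show ?thesis
    proof (rule ccontr)
      assume q0: "q0 \<noteq> 0"
      have "q0 * (p1 * q2) = q0 * (p2 * q1)" using P1(1) P2(1) by (metis mult.assoc mult.commute)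
      then have e1: "p1 * q2 = p2 * q1" using q0 by simp
      have "q0 * (r1 * q2) = q0 * (r2 * q1)" using P1(2) P2(2) by (metis mult.assoc mult.commute)
      then have e2: "r1 * q2 = r2 * q1" using q0 by simp
      \<comment> \<open>Nonparallel lines meet only once, so the two triples are proportional;
        minimality on both sides makes them equal, and equal triples have the same line.\<close>
      have "q1 = q2"
        using nearest_proportional[OF I1(2) I2(2) e1 e2] nearest_proportional[OF I2(2) I1(2) e1[symmetric] e2[symmetric]]
        by simp
      then have "(q1, p1, r1) = (q2, p2, r2)" using e1 e2 I1(5) by auto
      then have "A1 = A2" "B1 = B2" using I1(4) I2(4) by auto
      then show False using q0 by (simp add: q0_def)
    qed
  qed
  \<comment> \<open>Once \<open>q0\<close> vanishes, the errors bound the integers \<open>p0\<close>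
    and \<open>r0\<close> themselves. The lower bound on \<open>S\<close> makes both less than
    1.\<close>
  moreover have "p0 = 0"
  proof -
    have "8 * (E * t) \<le> 8 * (1 / S)" using admissible_bounds(1)[OF admissible] by (simp add: E_def t_def Q_def)
    also have "\<dots> < 1" using S_ge by simp
    finally show ?thesis using hp \<open>q0 = 0\<close> by simp
  qed
  moreover have "r0 = 0"
  proof -
    have "8 * ((2 * D + E * S1) * t) = 16 * (D * t) + 8 * S1 * (E * t)" by (simp add: algebra_simps)
    also have "\<dots> \<le> 16 * (1 / S) + 8 * S1 * (1 / S)"
      using admissible_bounds(1,2)[OF admissible] S1 by (intro add_mono mult_left_mono) (auto simp: E_def D_def t_def Q_def)
    also have "\<dots> = (16 + 8 * S1) / S" by (simp add: add_divide_distrib)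
    also have "\<dots> < 1" using S S_pos by simp
    finally show ?thesis using hr \<open>q0 = 0\<close> by simp
  qed
  ultimately show "A1 * B2 = A2 * B1" "B1 * C2 = B2 * C1" "C1 * A2 = C2 * A1"
    by (simp_all add: q0_def p0_def r0_def)
qed

text \<open>The alternatives are the two ways in which k can be maximal: the slope at x exceeds the
  next smaller bound, or admissibility fails at k + 1. In the second case (\<open>deg\<close>) the
  slope may vanish, and the curvature, of order B f'', takes over.\<close>

definition steep :: "nat \<Rightarrow> nat \<Rightarrow> nat \<Rightarrow> bool \<Rightarrow> real \<Rightarrow> int \<Rightarrow> int \<Rightarrow> bool" where
  "steep u k v deg x A B \<longleftrightarrow>
    (if deg then coeff_bound u v / 2 \<le> \<bar>real_of_int B\<bar> \<and> 2 ^ u * (slope_bound u k)\<^sup>2 \<le> 8 * (S * gain k v * c * coeff_bound u v)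
     else slope_bound u k / 2 \<le> \<bar>A + B * f' x\<bar>)"

text \<open>The sign \<open>s\<close> tells on which side of the extremal point of \<open>A x + B f x\<close> the point \<open>x\<close> lies.\<close>

definition rising :: "real \<Rightarrow> real \<Rightarrow> int \<Rightarrow> int \<Rightarrow> bool" where
  "rising s x A B \<longleftrightarrow> 0 \<le> s * (\<epsilon> * B * (A + B * f' x))"

text \<open>The expression is homogeneous of degree 2 in (A, B), so passing to a proportional line
  multiplies it by a square.\<close>

lemma rising_transfer:
  assumes p: "A1 * B2 = A2 * B1" "B1 * C2 = B2 * C1"
    and nz: "A2 \<noteq> 0 \<or> B2 \<noteq> 0" and r: "rising s x A2 B2"
  shows "rising s x A1 B1"
proof (cases "B2 = 0")
  case True
  then have "B1 = 0" using p nz by auto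
  then show ?thesis by (simp add: rising_def)
next
  case False
  have pr: "real_of_int A1 * B2 = real_of_int A2 * B1" using p(1) by (metis of_int_mult)
  have "s * (\<epsilon> * B1 * (A1 + B1 * f' x)) * (real_of_int B2)\<^sup>2
      = s * (\<epsilon> * B1 * B2 * (real_of_int A1 * B2 + B1 * B2 * f' x))"
    by (simp add: power2_eq_square algebra_simps)
  also have "\<dots> = s * (\<epsilon> * B2 * (A2 + B2 * f' x)) * (real_of_int B1)\<^sup>2"
    unfolding pr by (simp add: power2_eq_square algebra_simps)
  also have "\<dots> \<ge> 0" using r by (simp add: rising_def)
  finally show ?thesis using False unfolding rising_def by (simp add: zero_le_mult_iff)
qed

text \<open>Since f'' has constant sign, f' is monotone and the slope at t lies between the slopes
  at x and y, which do not have opposite signs.\<close>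

lemma slope_between:
  assumes xy: "x \<in> {a..b}" "y \<in> {a..b}" and t: "t \<in> {a..b}" "min x y \<le> t" "t \<le> max x y"
    and d: "d \<le> \<bar>A + B * f' x\<bar>" "d \<le> \<bar>A + B * f' y\<bar>" and s: "0 \<le> (A + B * f' x) * (A + B * f' y)"
  shows "d \<le> \<bar>A + B * f' t\<bar>"
proof -
  have mono: "\<epsilon> * f' z \<le> \<epsilon> * f' w" if zw: "z \<in> {a..b}" "w \<in> {a..b}" "z \<le> w" for z w
  proof -
    obtain \<xi> where \<xi>: "\<xi> \<in> {a..b}" "f' w - f' z = f'' \<xi> * (w - z)"
      using mvt_within[OF f'' zw(2,1)] by metis
    have "\<epsilon> * f' w - \<epsilon> * f' z = (\<epsilon> * f'' \<xi>) * (w - z)"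
      by (simp add: \<xi>(2) right_diff_distrib[symmetric])
    also have "\<dots> \<ge> 0"
    proof (rule mult_nonneg_nonneg)
      show "0 \<le> \<epsilon> * f'' \<xi>" using m(1) m(2)[OF \<xi>(1)] by linarith
    qed (use zw in simp)
    finally show ?thesis by simp
  qed
  have "\<epsilon> * f' (min x y) \<le> \<epsilon> * f' t \<and> \<epsilon> * f' t \<le> \<epsilon> * f' (max x y)"
    using xy t by (auto intro!: mono simp: min_def max_def)
  then have "f' x \<le> f' t \<and> f' t \<le> f' y \<or> f' y \<le> f' t \<and> f' t \<le> f' x"
    using \<epsilon> by (auto simp: min_def max_def abs_if split: if_splits)
  then have "(A + B * f' x \<le> A + B * f' t \<and> A + B * f' t \<le> A + B * f' y)
      \<or> (A + B * f' y \<le> A + B * f' t \<and> A + B * f' t \<le> A + B * f' x)"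
    by (cases "0 \<le> B") (auto intro: mult_left_mono mult_left_mono_neg)
  then show ?thesis using d s by (auto simp: zero_le_mult_iff)
qed

text \<open>Proportionality with a bounded ratio carries the small value of the second line at x2
  over to the first, so one function F is O(c/Q) at both points. A slope of at least D/8 between
  them gives h = O(reach / gain) by the mean value theorem; in the degenerate case quadratic growth
  gives h = O(reach / sqrt gain).\<close>

lemma in_class_close:
  assumes admissible: "admissible u k v" and c1: "in_class u k v x1 q1 p1 r1 A1 B1 C1"
    and c2: "in_class u k v x2 q2 p2 r2 A2 B2 C2" and d: "\<bar>x1 - x2\<bar> \<le> reach u k v"
    and st: "steep u k v deg x1 A1 B1" "steep u k v deg x2 A2 B2"
    and ri: "rising s x1 A1 B1" "rising s x2 A2 B2" and s: "\<bar>s\<bar> = 1"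
  shows "\<bar>x1 - x2\<bar> \<le> reach u k v * (80 + sqrt (192 * S / m)) / sqrt (gain k v)"
proof -
  note I1 = in_classD[OF c1] and I2 = in_classD[OF c2]
  note par = in_class_parallel[OF admissible c1 c2 d]
  have pr: "real_of_int A1 * B2 = real_of_int A2 * B1" "real_of_int B1 * C2 = real_of_int B2 * C1"
    "real_of_int C1 * A2 = real_of_int C2 * A1"
    using par by (metis of_int_mult)+
  define Q where "Q = (2 ^ u :: real)"
  define X where "X = gain k v"
  define D where "D = slope_bound u k"
  define E where "E = coeff_bound u v"
  define h where "h = \<bar>x1 - x2\<bar>"
  have pos: "0 < Q" "0 < D" "0 < E" "1 \<le> X" "0 \<le> h"
    using slope_bound_pos coeff_bound_pos gain_ge_1 by (auto simp: Q_def D_def E_def X_def h_def)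
  have reach: "reach u k v = X * c / (Q * D)" by (simp add: reach_def X_def Q_def D_def)
  note v1 = I1(14)[folded Q_def] and v2 = I2(14)[folded Q_def]
  note r12 = rising_transfer[OF par(1,2) I2(10) ri(2)]
  have dF: "((\<lambda>z. A1 * z + B1 * f z + C1) has_real_derivative A1 + B1 * f' z) (at z within {a..b})"
    if "z \<in> {a..b}" for z
    using f'[OF that] by (auto intro!: derivative_eq_intros)
  show ?thesis
  proof (cases deg)
    case False
    have s1: "D / 2 \<le> \<bar>A1 + B1 * f' x1\<bar>" "D / 2 \<le> \<bar>A2 + B2 * f' x2\<bar>"
      using st False by (auto simp: steep_def D_def)
    have s2: "\<bar>A1 + B1 * f' x2\<bar> \<le> 2 * D" "\<bar>A2 + B2 * f' x1\<bar> \<le> 2 * D"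
      using in_class_spread(1)[OF admissible c1 I2(1)] in_class_spread(1)[OF admissible c2 I1(1)] d
      by (auto simp: D_def abs_minus_commute)
    \<comment> \<open>Proportional lines satisfy F1 F2' = F2 F1' at x2; the slopes differ by a
      factor of at most 4, which bounds F1 there.\<close>
    have "(A1 * x2 + B1 * f x2 + C1) * (A2 + B2 * f' x2) - (A2 * x2 + B2 * f x2 + C2) * (A1 + B1 * f' x2)
      = (real_of_int A1 * B2 - real_of_int A2 * B1) * (x2 * f' x2 - f x2)
        + (real_of_int C1 * A2 - real_of_int C2 * A1) - (real_of_int B1 * C2 - real_of_int B2 * C1) * f' x2"
      by (simp add: algebra_simps)
    also have "\<dots> = 0" unfolding pr by simp
    finally have "\<bar>(A1 * x2 + B1 * f x2 + C1) * (A2 + B2 * f' x2)\<bar>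
      = \<bar>(A2 * x2 + B2 * f x2 + C2) * (A1 + B1 * f' x2)\<bar>" by simp
    also have "\<dots> \<le> 2 * c / Q * (2 * D)"
      unfolding abs_mult using v2 s2 pos c by (intro mult_mono) auto
    finally have "\<bar>A1 * x2 + B1 * f x2 + C1\<bar> * (D / 2) \<le> 2 * c / Q * (2 * D)"
      using mult_left_mono[OF s1(2), of "\<bar>A1 * x2 + B1 * f x2 + C1\<bar>"] by (simp add: abs_mult)
    then have w: "\<bar>A1 * x2 + B1 * f x2 + C1\<bar> \<le> 8 * c / Q"
      using pos by (simp add: field_simps)
    have "(A1 + B1 * f' x2) * (A2 + B2 * f' x1) - (A2 + B2 * f' x2) * (A1 + B1 * f' x1)
      = (real_of_int A1 * B2 - real_of_int A2 * B1) * (f' x1 - f' x2)"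
      by (simp add: algebra_simps)
    also have "\<dots> = 0" unfolding pr by simp
    finally have "\<bar>A1 + B1 * f' x2\<bar> * \<bar>A2 + B2 * f' x1\<bar> = \<bar>A2 + B2 * f' x2\<bar> * \<bar>A1 + B1 * f' x1\<bar>"
      by (simp flip: abs_mult)
    also have "\<dots> \<ge> D / 2 * (D / 2)" using s1 pos by (intro mult_mono) auto
    finally have "D / 2 * (D / 2) \<le> \<bar>A1 + B1 * f' x2\<bar> * (2 * D)"
      using mult_left_mono[OF s2(2), of "\<bar>A1 + B1 * f' x2\<bar>"] by linarith
    then have low: "D / 8 \<le> \<bar>A1 + B1 * f' x2\<bar>" using pos by (simp add: field_simps)
    have sg: "0 \<le> (A1 + B1 * f' x1) * (A1 + B1 * f' x2)"
    proof (cases "B1 = 0")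
      case False
      have "0 \<le> (s * (\<epsilon> * B1 * (A1 + B1 * f' x1))) * (s * (\<epsilon> * B1 * (A1 + B1 * f' x2)))"
        using ri(1) r12 unfolding rising_def by (rule mult_nonneg_nonneg)
      also have "\<dots> = s\<^sup>2 * \<epsilon>\<^sup>2 * (real_of_int B1)\<^sup>2 * ((A1 + B1 * f' x1) * (A1 + B1 * f' x2))"
        by (simp add: power2_eq_square mult_ac)
      finally have "0 \<le> s\<^sup>2 * \<epsilon>\<^sup>2 * (real_of_int B1)\<^sup>2 * ((A1 + B1 * f' x1) * (A1 + B1 * f' x2))" .
      moreover have "s\<^sup>2 = 1" "\<epsilon>\<^sup>2 = 1" using s \<epsilon> by (metis power2_abs one_power2)+
      ultimately show ?thesis using False by (simp add: zero_le_mult_iff)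
    qed simp
    obtain t where t: "t \<in> {a..b}" "min x1 x2 \<le> t" "t \<le> max x1 x2"
      "(A1 * x1 + B1 * f x1 + C1) - (A1 * x2 + B1 * f x2 + C1) = (A1 + B1 * f' t) * (x1 - x2)"
      using mvt_within[OF dF I1(1) I2(1)] by metis
    have "D / 8 \<le> \<bar>A1 + B1 * f' t\<bar>"
      using s1(1) pos low by (intro slope_between[OF I1(1) I2(1) t(1-3) _ low sg]) simp
    then have "D / 8 * h \<le> \<bar>(A1 + B1 * f' t) * (x1 - x2)\<bar>"
      unfolding abs_mult h_def by (intro mult_right_mono) auto
    also have "\<dots> \<le> 2 * c / Q + 8 * c / Q" using t(4) v1 w by linarith
    finally have "h \<le> 80 * c / (Q * D)" using pos by (simp add: field_simps)
    also have "\<dots> = 80 * (reach u k v / X)" using pos unfolding reach by simp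
    also have "\<dots> \<le> 80 * (reach u k v / sqrt X)"
    proof -
      have "sqrt X \<le> X" using pos by (simp add: real_le_lsqrt self_le_power power2_eq_square)
      then show ?thesis using pos reach_pos[of u k v] by (intro mult_left_mono divide_left_mono) auto
    qed
    also have "\<dots> \<le> (80 + sqrt (192 * S / m)) * (reach u k v / sqrt X)"
      using pos reach_pos[of u k v] S_pos m by (intro mult_right_mono) auto
    finally show ?thesis by (simp add: h_def X_def mult_ac)
  next
    case True
    have b1: "E / 2 \<le> \<bar>real_of_int B1\<bar>" and b2: "E / 2 \<le> \<bar>real_of_int B2\<bar>"
      and dg: "Q * D\<^sup>2 \<le> 8 * (S * X * c * E)"
      using st True by (auto simp: steep_def E_def Q_def D_def X_def)
    have bE: "\<bar>real_of_int B1\<bar> \<le> 2 * \<bar>real_of_int B2\<bar>" using I1(9) b2 by (simp add: E_def)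
    have nz: "0 < \<bar>real_of_int B1\<bar>" "0 < \<bar>real_of_int B2\<bar>" using b1 b2 pos by auto
    have "(A1 * x2 + B1 * f x2 + C1) * B2 - (A2 * x2 + B2 * f x2 + C2) * B1
      = (real_of_int A1 * B2 - real_of_int A2 * B1) * x2 - (real_of_int B1 * C2 - real_of_int B2 * C1)"
      by (simp add: algebra_simps)
    also have "\<dots> = 0" unfolding pr by simp
    finally have "\<bar>A1 * x2 + B1 * f x2 + C1\<bar> * \<bar>real_of_int B2\<bar> = \<bar>A2 * x2 + B2 * f x2 + C2\<bar> * \<bar>real_of_int B1\<bar>"
      by (simp flip: abs_mult)
    also have "\<dots> \<le> 2 * c / Q * (2 * \<bar>real_of_int B2\<bar>)"
      using v2 bE pos c by (intro mult_mono) auto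
    also have "\<dots> = 4 * c / Q * \<bar>real_of_int B2\<bar>" by simp
    finally have w: "\<bar>A1 * x2 + B1 * f x2 + C1\<bar> \<le> 4 * c / Q"
      by (rule mult_right_le_imp_le[OF _ nz(2)])
    \<comment> \<open>The factor \<open>\<epsilon> * B1\<close> makes the second derivative positive
      whatever the signs of f'' and B1.\<close>
    have quad: "m * (real_of_int B1)\<^sup>2 * (x1 - x2)\<^sup>2 / 2
      \<le> \<bar>\<epsilon> * B1 * (A1 * x1 + B1 * f x1 + C1) - \<epsilon> * B1 * (A1 * x2 + B1 * f x2 + C1)\<bar>"
    proof (rule quadratic_growth[where g' = "\<lambda>z. \<epsilon> * B1 * (A1 + B1 * f' z)" and g'' = "\<lambda>z. \<epsilon> * (real_of_int B1)\<^sup>2 * f'' z"])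
      fix z assume z: "z \<in> {a..b}"
      show "((\<lambda>z. \<epsilon> * B1 * (A1 * z + B1 * f z + C1)) has_real_derivative \<epsilon> * B1 * (A1 + B1 * f' z)) (at z within {a..b})"
        using DERIV_cmult[OF dF[OF z]] .
      show "((\<lambda>z. \<epsilon> * B1 * (A1 + B1 * f' z)) has_real_derivative \<epsilon> * (real_of_int B1)\<^sup>2 * f'' z) (at z within {a..b})"
        using f''[OF z] by (auto intro!: derivative_eq_intros simp: power2_eq_square)
      show "m * (real_of_int B1)\<^sup>2 \<le> \<epsilon> * (real_of_int B1)\<^sup>2 * f'' z"
        using mult_right_mono[OF m(2)[OF z], of "(real_of_int B1)\<^sup>2"] by (simp add: mult_ac)
    next
      show "0 \<le> \<epsilon> * B1 * (A1 + B1 * f' x1) \<and> 0 \<le> \<epsilon> * B1 * (A1 + B1 * f' x2) \<or>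
        \<epsilon> * B1 * (A1 + B1 * f' x1) \<le> 0 \<and> \<epsilon> * B1 * (A1 + B1 * f' x2) \<le> 0"
        using ri(1) r12 s unfolding rising_def by (auto simp: abs_if split: if_splits)
    qed (use I1(1) I2(1) in auto)
    have "\<dots> = \<bar>real_of_int B1\<bar> * \<bar>(A1 * x1 + B1 * f x1 + C1) - (A1 * x2 + B1 * f x2 + C1)\<bar>"
      unfolding right_diff_distrib[symmetric] abs_mult \<epsilon> by simp
    also have "\<dots> \<le> \<bar>real_of_int B1\<bar> * (6 * c / Q)"
    proof (intro mult_left_mono)
      have "2 * c / Q + 4 * c / Q = 6 * c / Q" by (simp add: add_divide_distrib[symmetric])
      then show "\<bar>(A1 * x1 + B1 * f x1 + C1) - (A1 * x2 + B1 * f x2 + C1)\<bar> \<le> 6 * c / Q"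
        using v1 w by linarith
    qed simp
    finally have "m * (real_of_int B1)\<^sup>2 * (x1 - x2)\<^sup>2 / 2 \<le> \<bar>real_of_int B1\<bar> * (6 * c / Q)"
      using quad by linarith
    moreover have "(real_of_int B1)\<^sup>2 = \<bar>real_of_int B1\<bar> * \<bar>real_of_int B1\<bar>" "(x1 - x2)\<^sup>2 = h\<^sup>2"
      by (simp_all add: power2_eq_square h_def)
    moreover have "m * (y * y) * z / 2 = y * (m * y * z / 2)" for y z :: real by simp
    ultimately have "\<bar>real_of_int B1\<bar> * (m * \<bar>real_of_int B1\<bar> * h\<^sup>2 / 2) \<le> \<bar>real_of_int B1\<bar> * (6 * c / Q)"
      by metis
    then have "m * \<bar>real_of_int B1\<bar> * h\<^sup>2 / 2 \<le> 6 * c / Q"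
      by (rule mult_left_le_imp_le[OF _ nz(1)])
    moreover have "m * (E / 2) * h\<^sup>2 / 2 \<le> m * \<bar>real_of_int B1\<bar> * h\<^sup>2 / 2"
      using b1 m by (intro divide_right_mono mult_right_mono mult_left_mono) auto
    ultimately have "m * (E / 2) * h\<^sup>2 / 2 \<le> 6 * c / Q" by linarith
    then have h2: "h\<^sup>2 \<le> 24 * c / (Q * m * E)" using pos m by (simp add: field_simps)
    \<comment> \<open>Degeneracy bounds D from above and hence \<open>reach\<close> from below; its
      factor 8 times the 24 in \<open>h2\<close> is the 192 of the statement.\<close>
    have "X * c / (8 * S * Q * E) \<le> (reach u k v)\<^sup>2"
    proof -
      have "X * c / (8 * S * Q * E) = (X * c)\<^sup>2 / (Q * (8 * (S * X * c * E)))"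
        using pos c S_pos by (simp add: power2_eq_square field_simps)
      also have "\<dots> \<le> (X * c)\<^sup>2 / (Q * (Q * D\<^sup>2))"
        using dg pos c S_pos by (intro divide_left_mono mult_left_mono mult_pos_pos) auto
      also have "\<dots> = (reach u k v)\<^sup>2" unfolding reach by (simp add: power2_eq_square)
      finally show ?thesis .
    qed
    then have "192 * S / m / X * (X * c / (8 * S * Q * E)) \<le> 192 * S / m / X * (reach u k v)\<^sup>2"
      using pos S_pos m by (intro mult_left_mono) auto
    moreover have "192 * S / m / X * (X * c / (8 * S * Q * E)) = 24 * c / (Q * m * E)"
      using pos S_pos m by (simp add: field_simps)
    ultimately have "h\<^sup>2 \<le> 192 * S / m / X * (reach u k v)\<^sup>2" using h2 by linarith
    then have "sqrt (h\<^sup>2) \<le> sqrt (192 * S / m / X * (reach u k v)\<^sup>2)" by (rule real_sqrt_le_mono)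
    then have "h \<le> sqrt (192 * S / m) * (reach u k v / sqrt X)"
      using pos reach_pos[of u k v] by (simp add: real_sqrt_mult real_sqrt_divide)
    also have "\<dots> \<le> (80 + sqrt (192 * S / m)) * (reach u k v / sqrt X)"
      using pos reach_pos[of u k v] by (intro mult_right_mono) auto
    finally show ?thesis by (simp add: h_def X_def mult_ac)
  qed
qed

text \<open>The indices v and k are stopping indices: the upper bounds hold there and one of them
  fails at the next index. That failure supplies the lower bounds in \<open>steep\<close>.\<close>

lemma classification:
  assumes x: "x \<in> {a..b}" and n: "near c q p r x"
  obtains u k v deg s q p r A B C where "admissible u k v" "in_class u k v x q p r A B C"
    "steep u k v deg x A B" "rising s x A B" "s = 1 \<or> s = - 1"
proof -
  define P where "P = (\<lambda>n. \<exists>q p r. near c q p r x \<and> q = int n)"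
  have "P (nat q)" using n by (auto simp: P_def near_def)
  define N where "N = (LEAST n. P n)"
  have "P N" using \<open>P (nat q)\<close> unfolding N_def by (rule LeastI)
  then obtain q p r where n: "near c q p r x" "q = int N" by (auto simp: P_def)
  have "nearest c q p r x"
    unfolding nearest_def
  proof (intro conjI n(1) allI impI)
    fix q' p' r' assume n': "near c q' p' r' x"
    then have "P (nat q')" by (auto simp: P_def near_def)
    then have "N \<le> nat q'" unfolding N_def by (rule Least_le)
    then show "q \<le> q'" using n n' by (auto simp: near_def)
  qed
  obtain A B C where L: "line_through (q, p, r) = (A, B, C)" by (cases "line_through (q, p, r)")
  have q: "1 \<le> q" using n by (simp add: near_def)
  note l = line_through[OF q L]
  have "1 \<le> nat q" using q by simp
  then obtain u where u: "2 ^ u \<le> nat q" "nat q < 2 ^ (u + 1)"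
    using ex_power_ivl1[of 2 "nat q"] by blast
  have u': "2 ^ u \<le> q" "q < 2 * 2 ^ u"
    using u q by (simp_all add: le_nat_iff nat_less_iff)
  define Q where "Q = (2 ^ u :: real)"
  have "real_of_int (2 ^ u) \<le> q" "real_of_int q < real_of_int (2 * 2 ^ u)"
    using u' by (simp_all only: of_int_le_iff of_int_less_iff)
  then have Q: "1 \<le> Q" "Q \<le> q" "q \<le> 2 * Q" by (simp_all add: Q_def)
  have e: "q powr e \<le> 2 * Q powr e" if "0 \<le> e" "e \<le> 1" for e
    using powr_mono2[of e q "2 * Q"] double_powr_le[of Q e] that q Q by simp
  have AB: "\<bar>real_of_int A\<bar> \<le> 2 * Q powr i" "\<bar>real_of_int B\<bar> \<le> 2 * Q powr j"
    using l e[of i] e[of j] ij by auto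
  \<comment> \<open>The maximum with 1 makes the search for v stop even when B = 0.\<close>
  define M where "M = max 1 \<bar>real_of_int B\<bar>"
  have arch: "\<exists>N. \<forall>n\<ge>N. y / 2 ^ n < z" if "0 < z" for y z :: real
  proof -
    have "(\<lambda>n. y / 2 ^ n) \<longlonglongrightarrow> 0" by (rule LIMSEQ_divide_realpow_zero) simp
    then have "\<forall>\<^sub>F n in sequentially. y / 2 ^ n < z" using that by (rule order_tendstoD)
    then show ?thesis by (simp add: eventually_sequentially)
  qed
  have "\<exists>N. \<forall>n\<ge>N. \<not> M \<le> coeff_bound u n"
  proof -
    have "0 < M" by (simp add: M_def)
    from arch[OF this, of "2 * (2 ^ u) powr j"] show ?thesis by (simp add: coeff_bound_def not_le)
  qed
  moreover have "M \<le> coeff_bound u 0"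
    using AB ge_one_powr_ge_zero[OF Q(1), of j] ij by (auto simp: M_def coeff_bound_def Q_def)
  ultimately obtain v where v: "M \<le> coeff_bound u v" "\<not> M \<le> coeff_bound u (Suc v)"
    using ex_largest_nat[of "\<lambda>n. M \<le> coeff_bound u n"] by blast
  have B1: "1 \<le> coeff_bound u v" "\<bar>real_of_int B\<bar> \<le> coeff_bound u v" using v(1) by (auto simp: M_def)
  have Bs: "coeff_bound u (Suc v) = coeff_bound u v / 2" by (simp add: coeff_bound_def)
  define R where "R = (\<lambda>k. admissible u k v \<and> \<bar>A + B * f' x\<bar> \<le> slope_bound u k)"
  have "R 0"
    unfolding R_def
  proof
    have "\<bar>B * f' x\<bar> \<le> 2 * Q powr i * S1"
    proof -
      have "Q powr j \<le> Q powr i" using ij Q by (intro powr_mono) auto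
      then show ?thesis unfolding abs_mult using AB S1(1)[OF x] by (intro mult_mono) auto
    qed
    then show "\<bar>A + B * f' x\<bar> \<le> slope_bound u 0"
      using AB(1) by (simp add: slope_bound_def S0_def Q_def[symmetric] algebra_simps)
    have "gain 0 v * coeff_bound u v = 2 * X0 * Q powr j * ((2 ^ v) powr (j / 2) / 2 ^ v)"
      by (simp add: gain_def coeff_bound_def Q_def)
    also have "\<dots> \<le> 2 * X0 * Q powr j * 1"
      using powr_le_self[of "2 ^ v" "j / 2"] ij X0 by (intro mult_left_mono) auto
    finally have "S * c * (gain 0 v * coeff_bound u v) \<le> S * c * (2 * X0 * Q powr j)"
      using S_pos c by (intro mult_left_mono) auto
    also have "\<dots> = (2 * X0 * S * c) * Q powr j" by simp
    also have "\<dots> \<le> 1 * (Q * (S0 * Q powr i)\<^sup>2)"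
    proof (intro mult_mono)
      have "2 * X0 * S * c \<le> 2 * X0 * S0 * S * c"
        using X0 S_ge c S_pos by simp
      then show "2 * X0 * S * c \<le> 1" using c_small(1) by linarith
      have "1 \<le> S0 * Q powr i"
        using mult_mono[of 1 S0 1 "Q powr i"] S_ge ge_one_powr_ge_zero[OF Q(1), of i] ij by simp
      then have "1 \<le> (S0 * Q powr i)\<^sup>2" by (simp add: one_le_power)
      then show "Q powr j \<le> Q * (S0 * Q powr i)\<^sup>2"
        using powr_le_self[OF Q(1), of j] ij Q mult_mono[of "Q powr j" Q 1 "(S0 * Q powr i)\<^sup>2"] by simp
    qed auto
    finally show "admissible u 0 v"
      using B1 by (simp add: admissible_def slope_bound_def Q_def mult_ac)
  qed
  moreover have "\<exists>N. \<forall>k\<ge>N. \<not> R k"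
  proof -
    define z where "z = S * X0 * c"
    have z: "0 < z" using S_pos X0 c by (simp add: z_def)
    obtain N where N: "\<And>k. k \<ge> N \<Longrightarrow> Q * (S0 * Q powr i)\<^sup>2 / 2 ^ k < z"
      using arch[OF z] by blast
    have "\<not> R k" if "k \<ge> N" for k
    proof
      assume "R k"
      then have "S * gain k v * c * coeff_bound u v \<le> Q * (slope_bound u k)\<^sup>2" by (simp add: R_def admissible_def Q_def)
      also have "\<dots> = Q * (S0 * Q powr i)\<^sup>2 / (2 ^ k * 2 ^ k)" by (simp add: slope_bound_def Q_def power2_eq_square)
      also have "\<dots> \<le> Q * (S0 * Q powr i)\<^sup>2 / 2 ^ k"
        using Q by (intro divide_left_mono) auto
      also have "\<dots> < z" using N that by simp
      also have "z = S * X0 * c * 1" by (simp add: z_def)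
      also have "\<dots> \<le> S * gain k v * c * coeff_bound u v"
      proof (intro mult_mono)
        have "X0 * 1 \<le> X0 * (2 ^ (k + v)) powr (j / 2)"
          using X0 ij by (intro mult_left_mono ge_one_powr_ge_zero) auto
        then show "X0 \<le> gain k v" by (simp add: gain_def)
      qed (use S_pos c B1 X0 gain_pos[of k v] in auto)
      finally show False by simp
    qed
    then show ?thesis by blast
  qed
  ultimately obtain k where k: "R k" "\<not> R (Suc k)" using ex_largest_nat[of R] by blast
  have Ds: "slope_bound u (Suc k) = slope_bound u k / 2" by (simp add: slope_bound_def)
  have admissible: "admissible u k v" using k by (simp add: R_def)
  have cl: "in_class u k v x q p r A B C"
    using x \<open>nearest c q p r x\<close> L u' k B1 by (simp add: in_class_def R_def)
  have "steep u k v False x A B \<or> steep u k v True x A B"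
  proof (cases "admissible u (Suc k) v")
    case True
    then show ?thesis using k(2) by (simp add: R_def Ds steep_def)
  next
    \<comment> \<open>Passing to k + 1 quarters the squared slope bound and at most doubles the
      gain, whence the factor 8.\<close>
    case False
    have Xs: "gain (Suc k) v \<le> 2 * gain k v"
    proof -
      have "(2 * 2 ^ (k + v)) powr (j / 2) \<le> 2 * (2 ^ (k + v)) powr (j / 2)"
        using ij by (intro double_powr_le) auto
      then show ?thesis using X0 by (simp add: gain_def)
    qed
    have "2 ^ u * (slope_bound u k)\<^sup>2 / 4 < S * gain (Suc k) v * c * coeff_bound u v"
      using False B1 by (simp add: admissible_def Ds power2_eq_square)
    also have "\<dots> \<le> S * (2 * gain k v) * c * coeff_bound u v"
      using Xs S_pos c coeff_bound_pos[of u v] by (intro mult_right_mono mult_left_mono) auto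
    finally have deg: "2 ^ u * (slope_bound u k)\<^sup>2 \<le> 8 * (S * gain k v * c * coeff_bound u v)" by simp
    show ?thesis
    proof (cases "B = 0")
      case B: False
      then have "M = \<bar>real_of_int B\<bar>" by (auto simp: M_def)
      then show ?thesis using v(2) deg by (simp add: steep_def Bs)
    next
      \<comment> \<open>For B = 0 the slope is the nonzero integer A, so the slope bound is at least
        1; with \<open>deg\<close> and the smallness of c this is contradictory.\<close>
      case True
      then have "1 \<le> \<bar>A\<bar>" using l(1) by simp
      then have "1 \<le> \<bar>real_of_int A\<bar>" by linarith
      then have D1: "1 \<le> slope_bound u k" using k(1) True by (simp add: R_def)
      have E2: "coeff_bound u v < 2" using v(2) True by (simp add: M_def Bs)
      have "2 ^ (k + v) \<le> 2 ^ (k + v) * (slope_bound u k * coeff_bound u v)"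
        using mult_mono[OF D1 B1(1)] slope_bound_pos[of u k] by simp
      also have "\<dots> = 2 * S0 * Q" using slope_bound_coeff_bound by (simp add: Q_def)
      finally have "gain k v \<le> X0 * (2 * S0 * Q)"
        using powr_le_self[of "2 ^ (k + v)" "j / 2"] ij X0 unfolding gain_def
        by (intro mult_left_mono) auto
      have "Q * 1 \<le> Q * (slope_bound u k)\<^sup>2" using D1 Q by (intro mult_left_mono) (auto simp: one_le_power)
      also have "\<dots> \<le> 8 * (S * gain k v * c * coeff_bound u v)" using deg by (simp add: Q_def)
      also have "\<dots> < 8 * (S * gain k v * c * 2)"
        using E2 S_pos c gain_pos[of k v] by simp
      also have "\<dots> \<le> 8 * (S * (X0 * (2 * S0 * Q)) * c * 2)"
        using \<open>gain k v \<le> X0 * (2 * S0 * Q)\<close> S_pos c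
        by (intro mult_left_mono mult_right_mono) auto
      also have "\<dots> = (32 * S * S0 * X0 * c) * Q" by simp
      also have "\<dots> \<le> 1 * Q" using c_small(3) Q by (intro mult_right_mono) auto
      finally show ?thesis by simp
    qed
  qed
  moreover have "rising 1 x A B \<or> rising (- 1) x A B" by (auto simp: rising_def)
  ultimately show ?thesis using that[OF admissible cl] by blast
qed

end

subsection \<open>The clumps of a curved arc\<close>

context curved_arc
begin

text \<open>The last index selects the type of a clump: below \<open>4\<close> it encodes whether the slope or the
  curvature of the line is bounded below, and the sign of \<open>rising\<close>; \<open>4\<close> is the inhomogeneous case.\<close>

lemma clump_cover_exists:
  fixes \<gamma> \<delta> :: real
  assumes \<rho>: "0 < \<rho>" "\<rho> \<le> 1" and s: "0 < s" and L: "0 < L" "1 / S < L" and Y: "1 / \<rho> \<le> Y"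
    and W: "\<And>(C :: nat \<times> nat \<times> nat \<Rightarrow> real) \<theta> r. \<lbrakk>\<And>g. 0 < C g; 0 < \<theta>; \<theta> \<le> 1 / 2; 0 < r\<rbrakk> \<Longrightarrow>
      (\<integral>\<^sup>+(u, k, v, e). (if r \<le> C (k, v, e) * \<theta> ^ u \<and> C (k, v, e) * \<theta> ^ u < r / \<rho>
        then ennreal ((1 / (Y * 2 powr (j / 4 * real (k + v + e)))) powr s) else 0) \<partial>count_space UNIV)
      \<le> ennreal (1 / 48)"
  shows "\<exists>(Z :: nat \<times> nat \<times> nat \<times> nat \<Rightarrow> real set) \<l> h.
    clump_cover \<rho> s L ({a..b} - Bad_curve {a..b} f (\<gamma>, \<delta>) i j) Z \<l> h"
proof -
  have Y1: "1 \<le> Y" using Y \<rho> by (metis le_divide_eq_1_pos order_trans)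
  \<comment> \<open>The type index is at most 4 for every nonempty clump, so \<open>K\<close>
    absorbs its share of the weight.\<close>
  define K where "K = Y * 2 powr (4 * (j / 4))"
  have K1: "1 \<le> K"
    using mult_mono[of 1 Y 1 "2 powr (4 * (j / 4))"] Y1 ij ge_one_powr_ge_zero[of 2 "4 * (j / 4)"]
    by (simp add: K_def)
  define C1 where "C1 = 80 + sqrt (192 * S / m)"
  have C1: "80 \<le> C1" using S_pos m by (simp add: C1_def)
  \<comment> \<open>Then sqrt gain is K C1 2^((k+v)j/4), and the constant \<open>C1\<close> of
    \<open>in_class_close\<close> cancels in h.\<close>
  define X0 where "X0 = (K * C1)\<^sup>2"
  have KC: "1 \<le> K * C1" using mult_mono[of 1 K 1 C1] K1 C1 by simp
  then have X0: "1 \<le> X0" unfolding X0_def by (rule one_le_power)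
  have S02: "2 \<le> S0" using S1 by (simp add: S0_def)
  define N where "N = 8192 * S * S0\<^sup>2 * X0\<^sup>2"
  have SN: "S \<le> N" "1 \<le> N"
  proof -
    have "1 * 1 * (1 * 1) \<le> 8192 * S0\<^sup>2 * (X0\<^sup>2 * 1)"
      using S02 X0 by (intro mult_mono one_le_power) auto
    then have "S * 1 \<le> S * (8192 * S0\<^sup>2 * X0\<^sup>2)" using S_pos by (intro mult_left_mono) auto
    then show "S \<le> N" by (simp add: N_def mult_ac)
    then show "1 \<le> N" using S S1 by simp
  qed
  define c where "c = 1 / N"
  have cN: "0 < c" "c \<le> 1" "c \<le> 1 / S" "c * N = 1"
    using SN S_pos by (auto simp: c_def field_simps)
  interpret clumping i j a b f f' f'' S1 S m \<epsilon> X0 c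
    by unfold_locales (use X0 cN in \<open>auto simp: N_def\<close>)
  \<comment> \<open>The shift 2 c1 (1 + S1) uses a quarter of c, and 2 c2 \<le> c1 leaves the budget
    strict. The choice of c2 makes h/l equal to 1/K for inhomogeneous clumps.\<close>
  define c1 where "c1 = c / (8 * (1 + S1))"
  have c1: "0 < c1" "c1 \<le> c" "8 * (c1 * (1 + S1)) = c"
    using cN S1 by (auto simp: c1_def field_simps add_pos_nonneg)
  define c2 where "c2 = c1 / (2 * K)"
  have c2: "0 < c2" "c2 \<le> c1" "2 * c2 = c1 / K" using c1 K1 by (auto simp: c2_def field_simps)
  have c12: "2 * c2 + 2 * c1 * (1 + S1) < c" "c2 \<le> 1"
  proof -
    have "c1 * 1 \<le> c1 * (1 + S1)" using c1 S1 by (intro mult_left_mono) auto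
    then show "2 * c2 + 2 * c1 * (1 + S1) < c" using c1 c2 cN by linarith
    show "c2 \<le> 1" using c1 c2 cN by linarith
  qed
  define \<theta> where "\<theta> = (2::real) powr - (1 + i)"
  have \<theta>: "0 < \<theta>" "\<theta> \<le> 1 / 2"
    using ij powr_mono[of "- (1 + i)" "- 1" 2] by (auto simp: \<theta>_def)
  have \<theta>u: "\<theta> ^ u = 1 / (2 ^ u * (2 ^ u) powr i)" for u
  proof -
    have "\<theta> ^ u = (2 powr - (1 + i)) powr real u" by (simp add: powr_realpow \<theta>_def)
    also have "\<dots> = (2 powr real u) powr - (1 + i)" by (simp add: powr_powr mult.commute)
    also have "2 powr real u = (2 ^ u :: real)" by (simp add: powr_realpow)
    also have "(2 ^ u :: real) powr - (1 + i) = 1 / ((2 ^ u) powr 1 * (2 ^ u) powr i)"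
      by (simp only: powr_minus_divide powr_add)
    finally show ?thesis by simp
  qed
  \<comment> \<open>For fixed (k, v, e) the lengths form a geometric progression in u, since 2^u
    (2^u)^i is the inverse of \<theta>^u; this is the form required by the weight bound.\<close>
  define G where "G = (\<lambda>(k, v, e :: nat). if e < 4 then gain k v * c * 2 ^ k / S0 else c1)"
  have G: "0 < G g" for g
    using gain_pos cN c1 S02 by (auto simp: G_def split: prod.split intro!: divide_pos_pos mult_pos_pos)
  \<comment> \<open>Points with a homogeneous solution may be removed from the inhomogeneous clumps
    because the types below 4 cover them. The remaining indices carry the empty set and keep the
    index set a full product.\<close>
  define Z where "Z = (\<lambda>(u, k, v, e :: nat).
     if e < 4 then {x. \<exists>q p r A B C. admissible u k v \<and> in_class u k v x q p r A B C \<and>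
         steep u k v (2 \<le> e) x A B \<and> rising (if even e then 1 else - 1) x A B}
     else if (k, v, e) = (0, 0, 4) then inhom_near \<gamma> \<delta> c2 u - {x. \<exists>q p r. near c q p r x}
     else {})"
  define \<l> where "\<l> = (\<lambda>(u, g). G g * \<theta> ^ u)"
  define y where "y = (\<lambda>(k, v, e). Y * 2 powr (j / 4 * real (k + v + e)))"
  define h where "h = (\<lambda>(u, g). \<l> (u, g) / y g)"
  have y1: "1 / \<rho> \<le> y g" for g
  proof -
    obtain k v e where g: "g = (k, v, e)" by (cases g)
    have "Y * 1 \<le> Y * 2 powr (j / 4 * real (k + v + e))"
      using Y1 ij by (intro mult_left_mono ge_one_powr_ge_zero) auto
    then show ?thesis using Y by (simp add: y_def g)
  qed
  have y0: "0 < y g" for g using y1[of g] \<rho> by (meson divide_pos_pos less_le_trans zero_less_one)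
  have lpos: "0 < \<l> (u, g)" for u g using G \<theta> by (simp add: \<l>_def)
  have reach: "\<l> (u, k, v, e) = reach u k v" if "e < 4" for u k v e
    using that by (simp add: \<l>_def G_def reach_def slope_bound_def \<theta>u)
  show ?thesis
  proof (intro exI, unfold clump_cover_def, intro conjI allI ballI impI)
    fix \<kappa> :: "nat \<times> nat \<times> nat \<times> nat"
    obtain u k v e where \<kappa>: "\<kappa> = (u, k, v, e)" by (cases \<kappa>)
    show "0 < h \<kappa>" using lpos y0 by (simp add: h_def \<kappa>)
    have "1 \<le> \<rho> * y (k, v, e)" using y1[of "(k, v, e)"] \<rho> by (simp add: field_simps)
    then show "h \<kappa> \<le> \<rho> * \<l> \<kappa>"
      using lpos[of u "(k, v, e)"] y0[of "(k, v, e)"]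
      by (simp add: h_def \<kappa> divide_le_eq mult_ac mult_le_cancel_left1)
    show "\<l> \<kappa> < L" if "Z \<kappa> \<noteq> {}"
    proof (cases "e < 4")
      case True
      then have "admissible u k v" using that by (auto simp: Z_def \<kappa>)
      from admissible_bounds(3)[OF this] show ?thesis using L reach[OF True] by (simp add: \<kappa>)
    next
      case False
      have "\<theta> ^ u \<le> 1" using \<theta> by (intro power_le_one) auto
      then have "c1 * \<theta> ^ u \<le> c1 * 1" using c1 by (intro mult_left_mono) auto
      then have "c1 * \<theta> ^ u < L" using L c1 cN by linarith
      then show ?thesis using False by (simp add: \<l>_def G_def \<kappa>)
    qed
    fix x z assume x: "x \<in> Z \<kappa>" and z: "z \<in> Z \<kappa>" and d: "\<bar>x - z\<bar> \<le> \<l> \<kappa>"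
    show "\<bar>x - z\<bar> \<le> h \<kappa>"
    proof (cases "e < 4")
      case True
      obtain q1 p1 r1 A1 B1 D1 where 1: "admissible u k v" "in_class u k v x q1 p1 r1 A1 B1 D1"
        "steep u k v (2 \<le> e) x A1 B1" "rising (if even e then 1 else - 1) x A1 B1"
        using x True by (auto simp: Z_def \<kappa>)
      obtain q2 p2 r2 A2 B2 D2 where 2: "in_class u k v z q2 p2 r2 A2 B2 D2"
        "steep u k v (2 \<le> e) z A2 B2" "rising (if even e then 1 else - 1) z A2 B2"
        using z True by (auto simp: Z_def \<kappa>)
      have dl: "\<bar>x - z\<bar> \<le> reach u k v" using d reach[OF True] by (simp add: \<kappa>)
      have "\<bar>x - z\<bar> \<le> reach u k v * C1 / sqrt (gain k v)"
        unfolding C1_def by (rule in_class_close[OF 1(1,2) 2(1) dl 1(3) 2(2) 1(4) 2(3)]) simp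
      also have "\<dots> \<le> reach u k v * C1 / (y (k, v, e) * C1)"
      proof (intro divide_left_mono mult_pos_pos)
        have "y (k, v, e) \<le> Y * (2 powr (j / 4 * real (k + v)) * 2 powr (4 * (j / 4)))"
          unfolding y_def prod.case powr_add[symmetric]
          using True ij Y1 by (intro mult_left_mono powr_mono) (auto simp: algebra_simps)
        also have "\<dots> = K * 2 powr (j / 4 * real (k + v))" by (simp add: K_def)
        finally have "y (k, v, e) * C1 \<le> K * 2 powr (j / 4 * real (k + v)) * C1"
          using C1 by (intro mult_right_mono) auto
        also have "\<dots> = sqrt (gain k v)"
        proof -
          have "(2 ^ (k + v) :: real) powr (j / 2) = (2 powr (j / 4 * real (k + v)))\<^sup>2"
            by (simp add: powr_powr powr_realpow[symmetric] power2_eq_square mult.commute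
                del: powr_realpow flip: powr_add)
          moreover have "X0 * t = (K * C1 * w)\<^sup>2" if "t = w\<^sup>2" for t w
            by (simp add: that X0_def power_mult_distrib)
          ultimately have "gain k v = (K * C1 * 2 powr (j / 4 * real (k + v)))\<^sup>2"
            unfolding gain_def by blast
          then show ?thesis using KC by simp
        qed
        finally show "y (k, v, e) * C1 \<le> sqrt (gain k v)" .
      qed (use y0[of "(k, v, e)"] C1 reach_pos[of u k v] gain_pos[of k v] in auto)
      also have "\<dots> = h \<kappa>" using C1 reach[OF True] by (simp add: h_def \<kappa>)
      finally show ?thesis .
    next
      case False
      then have e: "k = 0" "v = 0" "e = 4" using x by (auto simp: Z_def \<kappa> split: if_splits)
      have hx: "x \<in> inhom_near \<gamma> \<delta> c2 u" "z \<in> inhom_near \<gamma> \<delta> c2 u"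
        "\<not> near c q p r x" "\<not> near c q p r z" for q p r
        using x z by (auto simp: Z_def \<kappa> e)
      have "\<bar>x - z\<bar> \<le> c1 * (2 powr - (1 + i)) ^ u"
        using d by (simp add: \<l>_def G_def \<kappa> e \<theta>_def)
      then have "\<bar>x - z\<bar> \<le> 2 * c2 * (2 powr - (1 + i)) ^ u"
        by (rule inhom_near_close[OF hx c1(1) c2(1) c12(1) cN(2)])
      also have "\<dots> = h \<kappa>"
        unfolding c2(3) by (simp add: h_def \<l>_def G_def \<kappa> e \<theta>_def y_def K_def)
      finally show ?thesis .
    qed
  next
    fix r :: real assume r: "0 < r"
    have "(\<integral>\<^sup>+\<kappa>. (if r \<le> \<l> \<kappa> \<and> \<l> \<kappa> < r / \<rho> then ennreal ((h \<kappa> / \<l> \<kappa>) powr s) else 0) \<partial>count_space UNIV)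
      = (\<integral>\<^sup>+(u, k, v, e). (if r \<le> G (k, v, e) * \<theta> ^ u \<and> G (k, v, e) * \<theta> ^ u < r / \<rho>
        then ennreal ((1 / (Y * 2 powr (j / 4 * real (k + v + e)))) powr s) else 0) \<partial>count_space UNIV)"
    proof (intro nn_integral_cong)
      fix \<kappa> :: "nat \<times> nat \<times> nat \<times> nat"
      obtain u k v e where \<kappa>: "\<kappa> = (u, k, v, e)" by (cases \<kappa>)
      have "h \<kappa> / \<l> \<kappa> = 1 / y (k, v, e)" using lpos[of u "(k, v, e)"] by (simp add: h_def \<kappa>)
      then show "(if r \<le> \<l> \<kappa> \<and> \<l> \<kappa> < r / \<rho> then ennreal ((h \<kappa> / \<l> \<kappa>) powr s) else 0)
        = (case \<kappa> of (u, k, v, e) \<Rightarrow> if r \<le> G (k, v, e) * \<theta> ^ u \<and> G (k, v, e) * \<theta> ^ u < r / \<rho>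
        then ennreal ((1 / (Y * 2 powr (j / 4 * real (k + v + e)))) powr s) else 0)"
        by (simp add: \<kappa> \<l>_def y_def)
    qed
    also have "\<dots> \<le> ennreal (1 / 48)" by (rule W[OF G \<theta> r])
    finally show "(\<integral>\<^sup>+\<kappa>. (if r \<le> \<l> \<kappa> \<and> \<l> \<kappa> < r / \<rho> then ennreal ((h \<kappa> / \<l> \<kappa>) powr s) else 0) \<partial>count_space UNIV)
      \<le> ennreal (1 / 48)" .
  next
    show "{a..b} - Bad_curve {a..b} f (\<gamma>, \<delta>) i j \<subseteq> (\<Union>\<kappa>. Z \<kappa>)"
    proof
      fix x assume "x \<in> {a..b} - Bad_curve {a..b} f (\<gamma>, \<delta>) i j"
      then have x: "x \<in> {a..b}" "x \<notin> Bad_curve {a..b} f (\<gamma>, \<delta>) i j" by auto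
      show "x \<in> (\<Union>\<kappa>. Z \<kappa>)"
      proof (cases "\<exists>q p r. near c q p r x")
        case True
        then obtain q p r where "near c q p r x" by blast
        from classification[OF x(1) this] obtain u k v deg \<sigma> q p r A B C where
          cl: "admissible u k v" "in_class u k v x q p r A B C" "steep u k v deg x A B" "rising \<sigma> x A B"
            "\<sigma> = 1 \<or> \<sigma> = - 1" .
        define e :: nat where "e = (if deg then 2 else 0) + (if \<sigma> = 1 then 0 else 1)"
        have e: "e < 4" "(2 \<le> e) = deg" "(if even e then 1 else - 1) = \<sigma>"
          using cl(5) by (auto simp: e_def)
        have "\<exists>q p r A B C. admissible u k v \<and> in_class u k v x q p r A B C \<and>
            steep u k v (2 \<le> e) x A B \<and> rising (if even e then 1 else - 1) x A B"
          unfolding e(2,3) using cl(1-4) by blast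
        then have "x \<in> Z (u, k, v, e)"
          by (simp only: Z_def prod.case e(1) if_True mem_Collect_eq)
        then show ?thesis by blast
      next
        case False
        obtain u where "x \<in> inhom_near \<gamma> \<delta> c2 u"
          using not_Bad_inhom_near[OF x c2(1) c12(2)] .
        then have "x \<in> Z (u, 0, 0, 4)" using False by (auto simp: Z_def)
        then show ?thesis by blast
      qed
    qed
  qed
qed

end

theorem theorem5:
  fixes i j a b \<gamma> \<delta> :: real and f f' f'' :: "real \<Rightarrow> real"
  assumes "0 < j" and "j \<le> i" and "i < 1" and "i + j = 1"
    and "a < b"
    and "\<And>x. x \<in> {a..b} \<Longrightarrow> (f has_real_derivative f' x) (at x within {a..b})"
    and "\<And>x. x \<in> {a..b} \<Longrightarrow> (f' has_real_derivative f'' x) (at x within {a..b})"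
    and "continuous_on {a..b} f''"
    and "\<And>x. x \<in> {a..b} \<Longrightarrow> f'' x \<noteq> 0"
  shows "alpha_winning {a..b} (1 / 2) (Bad_curve {a..b} f (\<gamma>, \<delta>) i j)"
  unfolding alpha_winning_def
proof (intro allI impI, elim conjE)
  fix \<beta> :: real assume \<beta>: "0 < \<beta>" "\<beta> < 1"
  obtain \<epsilon> m where m: "\<bar>\<epsilon>\<bar> = 1" "0 < m" "\<And>x. x \<in> {a..b} \<Longrightarrow> m \<le> \<epsilon> * f'' x"
    using constant_sign[OF assms(5,8,9)] by blast
  obtain S2 where S2: "0 \<le> S2" "\<And>x. x \<in> {a..b} \<Longrightarrow> \<bar>f'' x\<bar> \<le> S2"
    using continuous_on_interval_bounded[OF assms(8)] by blast
  have "continuous_on {a..b} f'" using assms(7) by (rule DERIV_continuous_on)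
  then obtain S1 where S1: "0 \<le> S1" "\<And>x. x \<in> {a..b} \<Longrightarrow> \<bar>f' x\<bar> \<le> S1"
    using continuous_on_interval_bounded by blast
  define \<rho> where "\<rho> = \<beta> / 2"
  have \<rho>: "0 < \<rho>" "\<rho> < 1" using \<beta> by (auto simp: \<rho>_def)
  \<comment> \<open>With this exponent |B_n|^s shrinks by 2/3 per round, more slowly than the
    potential under halving.\<close>
  define s where "s = ln (2 / 3) / ln \<rho>"
  have s: "0 < s" "\<rho> powr s = 2 / 3"
    using \<rho> by (auto simp: s_def divide_neg_neg powr_def)
  have "0 < j / 4" using assms(1) by simp
  from clump_weight[OF \<rho>(1) s(1) this, of "1 / \<rho>"] obtain Y where
    Y: "1 / \<rho> \<le> Y" "0 < Y" and
    W: "\<And>(C :: nat \<times> nat \<times> nat \<Rightarrow> real) \<theta> r. \<lbrakk>\<And>g. 0 < C g; 0 < \<theta>; \<theta> \<le> 1 / 2; 0 < r\<rbrakk> \<Longrightarrow>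
      (\<integral>\<^sup>+(u, k, v, e). (if r \<le> C (k, v, e) * \<theta> ^ u \<and> C (k, v, e) * \<theta> ^ u < r / \<rho>
        then ennreal ((1 / (Y * 2 powr (j / 4 * real (k + v + e)))) powr s) else 0) \<partial>count_space UNIV)
      \<le> ennreal (1 / 48)"
    by blast
  show "game_winning {a..b} (1 / 2) \<beta> (Bad_curve {a..b} f (\<gamma>, \<delta>) i j)"
  proof (rule game_winning_avoid_clumps[OF \<beta> s(1) s(2)[unfolded \<rho>_def], where 'k = "nat \<times> nat \<times> nat \<times> nat"])
    fix L :: real assume L: "0 < L"
    \<comment> \<open>The summands secure, in turn, the bound on |f''|, the margin over 16 + 8 S1,
      and 1 / S < L.\<close>
    define S where "S = S2 + (17 + 8 * S1) + 2 / L"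
    have S: "S2 \<le> S" "16 + 8 * S1 < S" "0 < S" "2 / L \<le> S"
      using S1 S2 L by (auto simp: S_def add_nonneg_pos add_pos_nonneg)
    have "1 / S < L" using S L by (simp add: field_simps)
    interpret curved_arc i j a b f f' f'' S1 S m \<epsilon>
    proof unfold_locales
      show "\<bar>f'' x\<bar> \<le> S" if "x \<in> {a..b}" for x using S2(2)[OF that] S by linarith
    qed (use assms m S1 S in auto)
    show "\<exists>(Z :: nat \<times> nat \<times> nat \<times> nat \<Rightarrow> real set) \<l> h.
      clump_cover (\<beta> / 2) s L ({a..b} - Bad_curve {a..b} f (\<gamma>, \<delta>) i j) Z \<l> h"
      using clump_cover_exists[OF \<rho>(1) less_imp_le[OF \<rho>(2)] s(1) L \<open>1 / S < L\<close> Y(1) W]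
      unfolding \<rho>_def .
  qed (auto simp: Bad_curve_def)
qed

end
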